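(* Let $p$ be a prime integer, and let $A$ be either $\mathbb{Z}$ or a discrete valuation ring with uniformizer $p$ that has a $p$-derivation. Let $S=A[x_1,\ldots,x_m]$ be a graded polynomial ring over $A$ with $\deg(x_i)>0$ for all $i$, let $f_1,\ldots,f_t\in S$ be homogeneous elements of positive degree, and let $R=A[f_1,\ldots,f_t]\subseteq S$. Assume that $R/(p)$ is a graded direct summand of $S/(p)$. Let $\mathfrak{m}=(f_1,\ldots,f_t)R+pR$ and $D=\max\{\deg(f_1),\ldots,\deg(f_t)\}$. Then $Q^{(nD)}\subseteq\mathfrak{m}^n$ for all $n\geq 1$ and all prime ideals $Q$ of $R$ such that $p\in Q\subseteq\mathfrak{m}$.
   Context: All rings are commutative with identity. Elements of $A$ have degree $0$ in $S$, and $R=A[f_1,\ldots,f_t]$ is the graded $A$-subalgebra of $S$ generated by $f_1,\ldots,f_t$. $p$-derivation: if $T$ is a ring in which $p$ is a nonzerodivisor, a map of sets $\delta:T\to T$ is a $p$-derivation if the map $\phi_p:T\to T$, $\phi_p(x)=x^p+p\,\delta(x)$, is a ring homomorphism. Graded direct summand: $R/(p)$ is a graded direct summand of $S/(p)$ if the natural map $R/(p)\to S/(p)$ is injective and there is a degree-preserving $R/(p)$-linear map $\overline{\beta}:S/(p)\to R/(p)$ that splits this inclusion. Symbolic powers: for a prime ideal $Q$ of $R$, $Q^{(n)}=Q^nR_Q\cap R$. *)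

theory Defs
  imports
    "HOL-Algebra.Algebra"
    "HOL-Algebra.Algebraic_Closure_Type"
    "HOL-Library.Poly_Mapping"
    "HOL-Computational_Algebra.Fraction_Field"
    "HOL-Computational_Algebra.Primes"
begin

text \<open>
  A subset \<open>K\<close> of a type carrying a ring structure, viewed as a ring with the operations
  inherited from the type. It is used for subrings \<open>K\<close> only.
\<close>

definition ring_on :: "'a::ring_1 set \<Rightarrow> 'a ring" where
  "ring_on K = ring_of_type_algebra\<lparr>carrier := K\<rparr>"


subsection \<open>The base ring\<close>

definition dvr :: "('a, 'b) ring_scheme \<Rightarrow> bool" where
  "dvr R \<longleftrightarrow> principal_domain R \<and> \<not> field R \<and> (\<exists>!M. maximalideal M R)"

definition uniformizer :: "('a, 'b) ring_scheme \<Rightarrow> 'a \<Rightarrow> bool" where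
  "uniformizer R u \<longleftrightarrow> u \<in> carrier R \<and> maximalideal (PIdl\<^bsub>R\<^esub> u) R"

definition p_derivation :: "nat \<Rightarrow> ('a::comm_ring_1 \<Rightarrow> 'a) \<Rightarrow> bool" where
  "p_derivation p \<delta> \<longleftrightarrow>
     (\<forall>x::'a. of_nat p * x = 0 \<longrightarrow> x = 0) \<and>
     (\<lambda>x. x ^ p + of_nat p * \<delta> x) \<in> ring_hom (ring_on UNIV) (ring_on UNIV)"


subsection \<open>Graded polynomial rings\<close>

text \<open>
  Polynomials in the countably many variables \<open>x\<^sub>0, x\<^sub>1, \<dots>\<close>: a monomial is a finitely supported
  exponent vector, a polynomial a finitely supported family of coefficients. The ring in \<open>m\<close>
  variables is the subring of the polynomials in which only \<open>x\<^sub>0, \<dots>, x\<^sub>m\<^sub>-\<^sub>1\<close> occur.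
\<close>

type_synonym 'a mpolynomial = "(nat \<Rightarrow>\<^sub>0 nat) \<Rightarrow>\<^sub>0 'a"

definition mpoly_in :: "nat \<Rightarrow> 'a::zero mpolynomial set" where
  "mpoly_in m = {P. \<forall>u \<in> Poly_Mapping.keys P. Poly_Mapping.keys u \<subseteq> {..<m}}"

definition mconst :: "'a::zero \<Rightarrow> 'a mpolynomial" where
  "mconst a = Poly_Mapping.single 0 a"

definition monom_degree :: "(nat \<Rightarrow> nat) \<Rightarrow> (nat \<Rightarrow>\<^sub>0 nat) \<Rightarrow> nat" where
  "monom_degree w u = (\<Sum>i\<in>Poly_Mapping.keys u. w i * Poly_Mapping.lookup u i)"

text \<open>
  The polynomials that are homogeneous of degree \<open>d\<close> when \<open>x\<^sub>i\<close> has degree \<open>w i\<close>;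
  as in any graded module, \<open>0\<close> belongs to every graded piece.
\<close>

definition homog :: "(nat \<Rightarrow> nat) \<Rightarrow> nat \<Rightarrow> 'a::zero mpolynomial set" where
  "homog w d = {P. \<forall>u \<in> Poly_Mapping.keys P. monom_degree w u = d}"

definition subalgebra_generated :: "'a::comm_ring_1 mpolynomial set \<Rightarrow> 'a mpolynomial set" where
  "subalgebra_generated F = generate_ring (ring_on UNIV) (range mconst \<union> F)"


subsection \<open>Graded direct summands modulo an element\<close>

text \<open>
  For a subring \<open>R\<close> of \<open>S\<close> and \<open>x \<in> R\<close>, the natural map from \<open>R/xR\<close> to \<open>S/xS\<close> sends the coset
  \<open>C = r + xR\<close> to \<open>r + xS\<close>, which is the sum of sets \<open>xS + C\<close>.
\<close>

definition quot_map :: "('a, 'b) ring_scheme \<Rightarrow> 'a \<Rightarrow> 'a set \<Rightarrow> 'a set" where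
  "quot_map S x C = PIdl\<^bsub>S\<^esub> x <+>\<^bsub>S\<^esub> C"

text \<open>
  Here \<open>G d \<inter> carrier S\<close> and \<open>G d \<inter> carrier R\<close> are the graded pieces of \<open>S\<close> and of its subring \<open>R\<close>.
  Their images are the graded pieces of the quotients.
\<close>

definition graded_direct_summand_mod ::
  "'a ring \<Rightarrow> 'a ring \<Rightarrow> (nat \<Rightarrow> 'a set) \<Rightarrow> 'a \<Rightarrow> bool" where
  "graded_direct_summand_mod R S G x \<longleftrightarrow>
    (let Rq = R Quot (PIdl\<^bsub>R\<^esub> x); Sq = S Quot (PIdl\<^bsub>S\<^esub> x); \<iota> = quot_map S x in
      inj_on \<iota> (carrier Rq) \<and>
      (\<exists>\<beta> \<in> carrier Sq \<rightarrow> carrier Rq.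
        (\<forall>a \<in> carrier Sq. \<forall>b \<in> carrier Sq. \<beta> (a \<oplus>\<^bsub>Sq\<^esub> b) = \<beta> a \<oplus>\<^bsub>Rq\<^esub> \<beta> b) \<and>
        (\<forall>r \<in> carrier Rq. \<forall>a \<in> carrier Sq. \<beta> (\<iota> r \<otimes>\<^bsub>Sq\<^esub> a) = r \<otimes>\<^bsub>Rq\<^esub> \<beta> a) \<and>
        (\<forall>r \<in> carrier Rq. \<beta> (\<iota> r) = r) \<and>
        (\<forall>d. \<forall>s \<in> G d \<inter> carrier S.
          \<exists>r \<in> G d \<inter> carrier R. \<beta> (PIdl\<^bsub>S\<^esub> x +>\<^bsub>S\<^esub> s) = PIdl\<^bsub>R\<^esub> x +>\<^bsub>R\<^esub> r)))"


subsection \<open>Symbolic powers\<close>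

definition ideal_power :: "('a, 'b) ring_scheme \<Rightarrow> 'a set \<Rightarrow> nat \<Rightarrow> 'a set" where
  "ideal_power R I n = I [^]\<^bsub>ideals_set R\<^esub> n"

text \<open>
  All rings here are subrings \<open>K\<close> of an integral domain, so the localization of \<open>K\<close> at a
  prime ideal \<open>Q\<close> is realized inside the field of fractions of the ambient domain.
\<close>

definition localization_at :: "'a::idom set \<Rightarrow> 'a set \<Rightarrow> 'a fract ring" where
  "localization_at K Q = ring_on {Fract a s | a s. a \<in> K \<and> s \<in> K - Q}"

definition symbolic_power :: "'a::idom set \<Rightarrow> 'a set \<Rightarrow> nat \<Rightarrow> 'a set" where
  "symbolic_power K Q n =
     {r \<in> K. Fract r 1 \<in>
        Idl\<^bsub>localization_at K Q\<^esub> ((\<lambda>a. Fract a 1) ` ideal_power (ring_on K) Q n)}"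

end

theory Submission
  imports Defs
begin

text \<open>
  The proof is a Zariski--Nagata argument in mixed characteristic. Differential operators together
  with a \<open>p\<close>-derivation \<open>\<delta>\<close> detect how deep an element lies in a symbolic power: each Hasse
  derivative of order \<open>k\<close> lowers the symbolic exponent by at most \<open>k\<close>, and \<open>\<delta>\<close> lowers it by at most
  one, provided that \<open>p\<close> lies in the ideal.

  These operators act on \<open>S\<close> and not on \<open>R\<close>, so the symbolic powers of \<open>Q\<close> have to be moved to \<open>S\<close>
  first. The splitting \<open>\<beta> : S/p \<rightarrow> R/p\<close> does this. Put \<open>J = {g \<in> S. \<beta>(h g) \<in> Q/p for all h \<in> S}\<close>. This is an
  ideal of \<open>S\<close> containing \<open>Q\<close>, and since \<open>\<beta>\<close> is \<open>R\<close>-linear and \<open>Q\<close> is prime, every element of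
  \<open>W = R - Q\<close> is a nonzerodivisor modulo \<open>J\<close>. If \<open>r \<in> Q\<^sup>(\<^sup>N\<^sup>)\<close>, then \<open>s r \<in> J\<^sup>N\<close> for some \<open>s \<in> W\<close>; the elements \<open>g\<close>
  of \<open>S\<close> with this property form the \<open>W\<close>-saturation of \<open>J\<^sup>N\<close>, which the operators lower as
  described (\<open>hasse_Jsat\<close>, \<open>p_derivation_Jsat\<close>). Because \<open>\<beta>\<close> preserves degrees and \<open>Q\<close> lies in
  \<open>\<mm>\<close>, the constant coefficients of the elements of \<open>J\<close> are divisible by \<open>p\<close>. Extracting the coefficient of a
  monomial \<open>x\<^sup>\<alpha>\<close> with a Hasse derivative of order \<open>|\<alpha>|\<close>, and removing a factor \<open>p\<^sup>b\<close> with \<open>b\<close>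
  applications of \<open>\<delta>\<close>, one obtains (\<open>coefficient_of_Jsat\<close>): no element of the saturation of \<open>J\<^sup>N\<close> has a
  coefficient \<open>p\<^sup>b u\<close> at \<open>x\<^sup>\<alpha>\<close> with \<open>p\<close> not dividing \<open>u\<close> and \<open>b + |\<alpha>| < N\<close>.

  On the other side, \<open>R\<close> is graded and a monomial of degree \<open>j\<close> in the generators has at least
  \<open>j/D\<close> factors, so the degree \<open>j\<close> component of an element of \<open>R\<close> lies in \<open>\<mm>\<^sup>k\<close> for \<open>k = \<lceil>j/D\<rceil>\<close>
  (\<open>component_in_ideal_power\<close>). Let \<open>r \<in> Q\<^sup>(\<^sup>n\<^sup>D\<^sup>)\<close> and suppose that its component of degree \<open>j\<close> is not
  in \<open>\<mm>\<^sup>n\<close>. Write it as \<open>p\<^sup>a x\<close> with \<open>x \<in> R\<close> and \<open>a\<close> maximal. Then \<open>a + k < n\<close>, hence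
  \<open>a + j < n D\<close>. Since \<open>R/p \<rightarrow> S/p\<close> is injective, maximality of \<open>a\<close> gives a coefficient of \<open>x\<close> that \<open>p\<close> does not
  divide, at some \<open>x\<^sup>\<alpha>\<close> of degree \<open>j \<ge> |\<alpha>|\<close>. This contradicts the previous paragraph with \<open>b = a\<close>
  and \<open>N = n D\<close>.
\<close>

section \<open>Ideals and their powers in rings carried by a type\<close>

lemma ring_on_simps [simp]:
  "carrier (ring_on K) = K" "monoid.mult (ring_on K) = (*)" "ring.add (ring_on K) = (+)"
  "monoid.one (ring_on K) = 1" "ring.zero (ring_on K) = 0"
  by (simp_all add: ring_on_def ring_of_type_algebra_def)

lemma cring_ring_on_UNIV: "cring (ring_on (UNIV :: 'a::comm_ring_1 set))"
  using ring_from_type_algebra cring_from_type_algebra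
  by (auto simp: ring_on_def ring_of_type_algebra_def)

lemma cring_ring_on:
  fixes K :: "'a::comm_ring_1 set"
  assumes "1 \<in> K" "\<And>x. x \<in> K \<Longrightarrow> - x \<in> K"
    "\<And>x y. x \<in> K \<Longrightarrow> y \<in> K \<Longrightarrow> x + y \<in> K" "\<And>x y. x \<in> K \<Longrightarrow> y \<in> K \<Longrightarrow> x * y \<in> K"
  shows "cring (ring_on K)"
proof (rule cringI)
  have z: "0 \<in> K" using assms(3)[OF assms(1) assms(2)[OF assms(1)]] by simp
  show "abelian_group (ring_on K)"
    by (rule abelian_groupI) (use assms z in \<open>auto simp: algebra_simps intro: bexI[of _ "- _"]\<close>)
  show "comm_monoid (ring_on K)"
    by unfold_locales (use assms in \<open>auto simp: algebra_simps\<close>)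
qed (auto simp: algebra_simps)

lemma ring_on_minus:
  assumes "cring (ring_on K)" "x \<in> K"
  shows "- x \<in> K" "\<ominus>\<^bsub>ring_on K\<^esub> x = - x"
proof -
  interpret cring "ring_on K" by fact
  have "\<ominus>\<^bsub>ring_on K\<^esub> x \<in> K" "x + \<ominus>\<^bsub>ring_on K\<^esub> x = 0"
    using a_inv_closed[of x] r_neg[of x] assms(2) by auto
  thus "- x \<in> K" "\<ominus>\<^bsub>ring_on K\<^esub> x = - x"
    by (metis add_eq_0_iff)+
qed

lemma ring_on_closed:
  assumes "cring (ring_on K)"
  shows "0 \<in> K" "1 \<in> K" "x \<in> K \<Longrightarrow> y \<in> K \<Longrightarrow> x + y \<in> K"
    "x \<in> K \<Longrightarrow> y \<in> K \<Longrightarrow> x - y \<in> K" "x \<in> K \<Longrightarrow> y \<in> K \<Longrightarrow> x * y \<in> K" "x \<in> K \<Longrightarrow> x ^ n \<in> K"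
    "of_nat n \<in> K"
proof -
  interpret cring "ring_on K" by fact
  show 1: "0 \<in> K" "1 \<in> K" "x \<in> K \<Longrightarrow> y \<in> K \<Longrightarrow> x * y \<in> K"
    and 2: "\<And>x y. x \<in> K \<Longrightarrow> y \<in> K \<Longrightarrow> x + y \<in> K"
    using zero_closed one_closed m_closed a_closed by auto
  show "x \<in> K \<Longrightarrow> y \<in> K \<Longrightarrow> x - y \<in> K"
    using 2[of x "-y"] ring_on_minus[OF assms, of y] by simp
  show "x \<in> K \<Longrightarrow> x ^ n \<in> K"
    by (induction n) (use one_closed m_closed in auto)
  show "of_nat n \<in> K" by (induction n) (use 1 2 in auto)
qed

lemma ideal_ring_onI:
  fixes K :: "'a::comm_ring_1 set"
  assumes K: "cring (ring_on K)" and "I \<subseteq> K" "0 \<in> I"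
    "\<And>x y. x \<in> I \<Longrightarrow> y \<in> I \<Longrightarrow> x + y \<in> I" "\<And>x y. x \<in> I \<Longrightarrow> y \<in> K \<Longrightarrow> y * x \<in> I"
  shows "ideal I (ring_on K)"
proof (rule idealI)
  interpret cring "ring_on K" by fact
  show "ring (ring_on K)" by (rule ring_axioms)
  show "subgroup I (add_monoid (ring_on K))"
  proof (rule add.subgroupI)
    show "I \<subseteq> carrier (ring_on K)" "I \<noteq> {}" using assms by auto
    fix x y assume "x \<in> I" "y \<in> I"
    thus "x \<oplus>\<^bsub>ring_on K\<^esub> y \<in> I" using assms by simp
    have "- 1 \<in> K" using ring_on_minus[OF K] ring_on_closed[OF K] by auto
    thus "\<ominus>\<^bsub>ring_on K\<^esub> x \<in> I"
      using assms(5)[OF \<open>x \<in> I\<close>, of "-1"] ring_on_minus(2)[OF K] \<open>x \<in> I\<close> \<open>I \<subseteq> K\<close> by auto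
  qed
  fix a x assume "a \<in> I" "x \<in> carrier (ring_on K)"
  thus "x \<otimes>\<^bsub>ring_on K\<^esub> a \<in> I" "a \<otimes>\<^bsub>ring_on K\<^esub> x \<in> I"
    using assms by (auto simp: mult.commute[of a])
qed

lemma ideal_ring_onD:
  assumes "ideal I (ring_on K)"
  shows "I \<subseteq> K" "0 \<in> I" "x \<in> I \<Longrightarrow> y \<in> I \<Longrightarrow> x + y \<in> I" "x \<in> I \<Longrightarrow> y \<in> K \<Longrightarrow> y * x \<in> I"
    "x \<in> I \<Longrightarrow> y \<in> K \<Longrightarrow> x * y \<in> I"
proof -
  interpret ideal I "ring_on K" by fact
  show "I \<subseteq> K" using a_subset by simp
  show "0 \<in> I" using additive_subgroup.zero_closed[OF is_additive_subgroup] by simp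
  show "x \<in> I \<Longrightarrow> y \<in> I \<Longrightarrow> x + y \<in> I" using additive_subgroup.a_closed[OF is_additive_subgroup] by simp
  show "x \<in> I \<Longrightarrow> y \<in> K \<Longrightarrow> y * x \<in> I" using I_l_closed by simp
  show "x \<in> I \<Longrightarrow> y \<in> K \<Longrightarrow> x * y \<in> I" using I_r_closed by simp
qed

lemma ideal_ring_on_diff:
  assumes "cring (ring_on K)" "ideal I (ring_on K)" "x \<in> I" "y \<in> I"
  shows "x - y \<in> I"
proof -
  have "(- 1) * y \<in> I"
    using ideal_ring_onD(4)[OF assms(2,4)] ring_on_minus(1)[OF assms(1), of 1] ring_on_closed[OF assms(1)]
    by blast
  from ideal_ring_onD(3)[OF assms(2,3) this] show ?thesis by simp
qed

lemma ideal_ring_on_sum: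
  assumes "ideal I (ring_on K)" "\<And>x. x \<in> C \<Longrightarrow> g x \<in> I"
  shows "sum g C \<in> I"
  using assms(2) by (induction C rule: infinite_finite_induct) (auto intro: ideal_ring_onD[OF assms(1)])

lemma ideal_power_0: "ideal_power R I 0 = carrier R"
  and ideal_power_Suc: "ideal_power R I (Suc n) = ideal_prod R (ideal_power R I n) I"
  by (simp_all add: ideal_power_def nat_pow_def ideals_set_def)

lemma ideal_power_ideal:
  assumes "cring (ring_on K)" "ideal I (ring_on K)"
  shows "ideal (ideal_power (ring_on K) I n) (ring_on K)"
proof -
  interpret cring "ring_on K" by fact
  show ?thesis
    using oneideal assms(2) by (induction n) (auto simp: ideal_power_0 ideal_power_Suc intro: ideal_prod_is_ideal)
qed

lemma ideal_power_Suc_mult: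
  "x \<in> ideal_power (ring_on K) I n \<Longrightarrow> y \<in> I \<Longrightarrow> x * y \<in> ideal_power (ring_on K) I (Suc n)"
  using ideal_prod.prod[of x "ideal_power (ring_on K) I n" y I "ring_on K"] by (simp add: ideal_power_Suc)

lemma ideal_power_Suc_induct [consumes 1, case_names prod sum]:
  assumes "z \<in> ideal_power (ring_on K) I (Suc n)"
    and "\<And>x y. x \<in> ideal_power (ring_on K) I n \<Longrightarrow> y \<in> I \<Longrightarrow> P (x * y)"
    and "\<And>x y. x \<in> ideal_power (ring_on K) I (Suc n) \<Longrightarrow> y \<in> ideal_power (ring_on K) I (Suc n) \<Longrightarrow>
      P x \<Longrightarrow> P y \<Longrightarrow> P (x + y)"
  shows "P z"
  using assms(1) unfolding ideal_power_Suc
  by (induction rule: ideal_prod.induct) (use assms(2,3) in \<open>auto simp: ideal_power_Suc\<close>)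

lemma ideal_power_mult:
  assumes "cring (ring_on K)" "ideal I (ring_on K)"
    and "x \<in> ideal_power (ring_on K) I i" "y \<in> ideal_power (ring_on K) I j"
  shows "x * y \<in> ideal_power (ring_on K) I (i + j)"
  using assms(4)
proof (induction j arbitrary: y)
  case 0
  thus ?case using ideal_ring_onD(5)[OF ideal_power_ideal[OF assms(1,2)] assms(3)]
    by (simp add: ideal_power_0)
next
  case (Suc j)
  from Suc.prems show ?case
  proof (induction rule: ideal_power_Suc_induct)
    case (prod a b)
    thus ?case using ideal_power_Suc_mult[OF Suc.IH[OF prod(1)] prod(2)] by (simp add: mult.assoc)
  next
    case (sum a b)
    thus ?case using ideal_ring_onD(3)[OF ideal_power_ideal[OF assms(1,2)]] by (simp add: distrib_left)
  qed
qed

lemma ideal_power_Suc_subset: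
  assumes "cring (ring_on K)" "ideal I (ring_on K)"
  shows "ideal_power (ring_on K) I (Suc n) \<subseteq> ideal_power (ring_on K) I n"
proof
  fix z assume "z \<in> ideal_power (ring_on K) I (Suc n)"
  thus "z \<in> ideal_power (ring_on K) I n"
  proof (induction rule: ideal_power_Suc_induct)
    case (prod x y)
    thus ?case using ideal_ring_onD(5)[OF ideal_power_ideal[OF assms] prod(1)] ideal_ring_onD(1)[OF assms(2)] by blast
  next
    case (sum x y)
    thus ?case by (intro ideal_ring_onD(3)[OF ideal_power_ideal[OF assms]])
  qed
qed

lemma ideal_power_antimono:
  assumes "cring (ring_on K)" "ideal I (ring_on K)" "i \<le> j"
  shows "ideal_power (ring_on K) I j \<subseteq> ideal_power (ring_on K) I i"
  by (rule lift_Suc_antimono_le[of "ideal_power (ring_on K) I", OF ideal_power_Suc_subset[OF assms(1,2)] assms(3)])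

lemma ideal_power_1:
  assumes "cring (ring_on K)" "ideal I (ring_on K)"
  shows "ideal_power (ring_on K) I (Suc 0) = I"
proof
  show "I \<subseteq> ideal_power (ring_on K) I (Suc 0)"
    using ideal_power_Suc_mult[of 1 K I 0] ring_on_closed(2)[OF assms(1)] by (auto simp: ideal_power_0)
  show "ideal_power (ring_on K) I (Suc 0) \<subseteq> I"
  proof
    fix z assume "z \<in> ideal_power (ring_on K) I (Suc 0)"
    thus "z \<in> I"
      by (induction rule: ideal_power_Suc_induct)
        (auto simp: ideal_power_0 intro: ideal_ring_onD[OF assms(2)])
  qed
qed

lemma ideal_power_mono_ring:
  assumes "K \<subseteq> L" "I \<subseteq> J" and L: "cring (ring_on L)" "ideal J (ring_on L)"
  shows "ideal_power (ring_on K) I n \<subseteq> ideal_power (ring_on L) J n"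
proof (induction n)
  case (Suc n)
  show ?case
  proof
    fix z assume "z \<in> ideal_power (ring_on K) I (Suc n)"
    thus "z \<in> ideal_power (ring_on L) J (Suc n)"
    proof (induction rule: ideal_power_Suc_induct)
      case (prod x y) thus ?case using Suc assms(2) by (intro ideal_power_Suc_mult) auto
    next
      case (sum x y) thus ?case by (intro ideal_ring_onD(3)[OF ideal_power_ideal[OF L]])
    qed
  qed
qed (use assms in \<open>simp add: ideal_power_0\<close>)

lemma power_in_ideal_power:
  assumes "cring (ring_on K)" "ideal I (ring_on K)" "x \<in> I"
  shows "x ^ n \<in> ideal_power (ring_on K) I n"
proof (induction n)
  case 0 thus ?case using ring_on_closed(2)[OF assms(1)] by (simp add: ideal_power_0)
next
  case (Suc n) thus ?case using ideal_power_Suc_mult[OF Suc assms(3)] by (metis power_Suc2)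
qed

section \<open>Symbolic powers\<close>

text \<open>The fractions with numerator in \<open>Q\<^sup>N\<close> already form an ideal of the localization, so
  membership in the extended ideal is witnessed by a single denominator.\<close>

lemma symbolic_power_denominator:
  fixes K :: "'a::idom set"
  assumes K: "cring (ring_on K)" and Q: "primeideal Q (ring_on K)" and r: "r \<in> symbolic_power K Q N"
  obtains s where "s \<in> K - Q" "s * r \<in> ideal_power (ring_on K) Q N"
proof -
  have Qi: "ideal Q (ring_on K)" using Q by (rule primeideal.axioms)
  define P where "P = ideal_power (ring_on K) Q N"
  have P: "ideal P (ring_on K)" unfolding P_def by (rule ideal_power_ideal[OF K Qi])
  note Kc = ring_on_closed[OF K]
  have Qp: "s * s' \<in> K - Q" if "s \<in> K - Q" "s' \<in> K - Q" for s s'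
    using that primeideal.I_prime[OF Q, of s s'] Kc by auto
  have Q1: "1 \<in> K - Q"
  proof -
    have "Q \<noteq> K" using primeideal.I_notcarr[OF Q] by auto
    moreover have "Q = K" if "1 \<in> Q" using ideal_ring_onD(1)[OF Qi] ideal_ring_onD(4)[OF Qi that] by auto
    ultimately show ?thesis using Kc by auto
  qed
  have nz: "s \<noteq> 0" if "s \<in> K - Q" for s using that ideal_ring_onD(2)[OF Qi] by auto
  define L where "L = {Fract a s | a s. a \<in> K \<and> s \<in> K - Q}"
  define M where "M = {Fract a s | a s. a \<in> P \<and> s \<in> K - Q}"
  have LI: "Fract a s \<in> L" if "a \<in> K" "s \<in> K - Q" for a s using that unfolding L_def by blast
  have MI: "Fract a s \<in> M" if "a \<in> P" "s \<in> K - Q" for a s using that unfolding M_def by blast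
  have PK: "P \<subseteq> K" by (rule ideal_ring_onD(1)[OF P])
  have cL: "cring (ring_on L)"
  proof (rule cring_ring_on)
    show "1 \<in> L" using LI[OF Kc(2) Q1] by (simp add: One_fract_def)
    fix x y assume "x \<in> L" "y \<in> L"
    then obtain a s b u where 1: "x = Fract a s" "y = Fract b u" "a \<in> K" "b \<in> K" "s \<in> K - Q" "u \<in> K - Q"
      unfolding L_def by blast
    show "- x \<in> L" using LI[of "-a" s] 1 ring_on_minus[OF K] by simp
    have "x + y = Fract (a * u + b * s) (s * u)" "x * y = Fract (a * b) (s * u)" using 1 nz by auto
    thus "x + y \<in> L" "x * y \<in> L" using 1 Qp Kc by (auto intro!: LI)
  qed
  have iM: "ideal M (ring_on L)"
  proof (rule ideal_ring_onI[OF cL])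
    show "M \<subseteq> L" using PK unfolding M_def L_def by blast
    show "0 \<in> M" using MI[OF ideal_ring_onD(2)[OF P] Q1] by (simp add: Zero_fract_def)
    fix x y assume "x \<in> M"
    then obtain a s where 1: "x = Fract a s" "a \<in> P" "s \<in> K - Q" unfolding M_def by blast
    { assume "y \<in> M"
      then obtain b u where 2: "y = Fract b u" "b \<in> P" "u \<in> K - Q" unfolding M_def by blast
      have "x + y = Fract (a * u + b * s) (s * u)" using 1 2 nz by auto
      moreover have "a * u + b * s \<in> P" using 1 2 ideal_ring_onD[OF P] by auto
      ultimately show "x + y \<in> M" using 1 2 Qp by (auto intro!: MI) }
    { assume "y \<in> L"
      then obtain b u where 2: "y = Fract b u" "b \<in> K" "u \<in> K - Q" unfolding L_def by blast
      have "y * x = Fract (b * a) (u * s)" using 1 2 nz by auto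
      moreover have "b * a \<in> P" using 1 2 ideal_ring_onD[OF P] by auto
      ultimately show "y * x \<in> M" using 1 2 Qp by (auto intro!: MI) }
  qed
  have "(\<lambda>a. Fract a 1) ` P \<subseteq> M" using Q1 by (auto intro!: MI)
  moreover have "Fract r 1 \<in> Idl\<^bsub>ring_on L\<^esub> ((\<lambda>a. Fract a 1) ` P)"
    using r by (simp add: symbolic_power_def localization_at_def L_def P_def)
  ultimately have "Fract r 1 \<in> M" using iM unfolding genideal_def by blast
  then obtain a s where "Fract r 1 = Fract a s" "a \<in> P" "s \<in> K - Q" unfolding M_def by blast
  moreover from this have "s * r = a" using nz by (simp add: eq_fract mult.commute)
  ultimately show thesis using that unfolding P_def by blast
qed

section \<open>Operators that lower symbolic powers\<close>

text \<open>The preimage of the extension of \<open>J\<^sup>N\<close> to the localization of the ring at \<open>W\<close>.\<close>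

definition saturated_power :: "'a::comm_ring_1 set \<Rightarrow> 'a set \<Rightarrow> nat \<Rightarrow> 'a set" where
  "saturated_power W J N = {g. \<exists>s\<in>W. s * g \<in> ideal_power (ring_on UNIV) J N}"

locale saturated_ideal =
  fixes J W :: "'a::comm_ring_1 set"
  assumes ideal_J: "ideal J (ring_on UNIV)"
    and W_1: "1 \<in> W"
    and W_mult: "s \<in> W \<Longrightarrow> u \<in> W \<Longrightarrow> s * u \<in> W"
    and W_regular: "s \<in> W \<Longrightarrow> s * g \<in> J \<Longrightarrow> g \<in> J"
begin

abbreviation "Jpow \<equiv> ideal_power (ring_on UNIV) J"
abbreviation "Jsat \<equiv> saturated_power W J"

lemmas cUNIV = cring_ring_on_UNIV[where 'a='a]
lemmas ideal_Jpow = ideal_power_ideal[OF cUNIV ideal_J]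

lemma Jpow_simps:
  "0 \<in> Jpow n" "x \<in> Jpow n \<Longrightarrow> y \<in> Jpow n \<Longrightarrow> x + y \<in> Jpow n"
  "x \<in> Jpow n \<Longrightarrow> y * x \<in> Jpow n" "x \<in> Jpow n \<Longrightarrow> x * y \<in> Jpow n"
  "x \<in> Jpow n \<Longrightarrow> y \<in> Jpow n \<Longrightarrow> x - y \<in> Jpow n"
  using ideal_ring_onD[OF ideal_Jpow[of n]] ideal_ring_on_diff[OF cUNIV ideal_Jpow[of n]] by auto

lemma Jpow_0 [simp]: "Jpow 0 = UNIV"
  by (simp add: ideal_power_0)

lemma Jpow_1 [simp]: "Jpow (Suc 0) = J"
  by (rule ideal_power_1[OF cUNIV ideal_J])

lemma Jpow_mult: "x \<in> Jpow i \<Longrightarrow> y \<in> Jpow j \<Longrightarrow> k \<le> i + j \<Longrightarrow> x * y \<in> Jpow k"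
  using ideal_power_mult[OF cUNIV ideal_J] ideal_power_antimono[OF cUNIV ideal_J] by blast

lemma Jpow_antimono: "x \<in> Jpow j \<Longrightarrow> i \<le> j \<Longrightarrow> x \<in> Jpow i"
  using ideal_power_antimono[OF cUNIV ideal_J] by blast

lemma Jpow_subset_Jsat: "x \<in> Jpow n \<Longrightarrow> x \<in> Jsat n"
  unfolding saturated_power_def using W_1 by (auto intro!: bexI[of _ 1])

lemma Jsat_saturated: "s \<in> W \<Longrightarrow> s * x \<in> Jsat n \<Longrightarrow> x \<in> Jsat n"
proof -
  assume "s \<in> W" "s * x \<in> Jsat n"
  then obtain u where "u \<in> W" "u * (s * x) \<in> Jpow n" unfolding saturated_power_def by blast
  hence "u * s \<in> W" "(u * s) * x \<in> Jpow n" using W_mult \<open>s \<in> W\<close> by (simp_all add: mult.assoc)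
  thus "x \<in> Jsat n" unfolding saturated_power_def by blast
qed

lemma Jsat_0 [simp]: "Jsat 0 = UNIV"
  using W_1 by (auto simp: saturated_power_def)

lemma Jsat_1 [simp]: "Jsat (Suc 0) = J"
proof
  show "Jsat (Suc 0) \<subseteq> J" using W_regular by (auto simp: saturated_power_def)
  show "J \<subseteq> Jsat (Suc 0)" using Jpow_subset_Jsat[of _ "Suc 0"] by auto
qed

lemma Jsat_antimono: "x \<in> Jsat j \<Longrightarrow> i \<le> j \<Longrightarrow> x \<in> Jsat i"
  unfolding saturated_power_def using Jpow_antimono by blast

lemma Jsat_mult:
  assumes "x \<in> Jsat i" "y \<in> Jsat j" "k \<le> i + j"
  shows "x * y \<in> Jsat k"
proof -
  obtain s u where "s \<in> W" "u \<in> W" "s * x \<in> Jpow i" "u * y \<in> Jpow j"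
    using assms unfolding saturated_power_def by blast
  moreover from this have "(s * u) * (x * y) \<in> Jpow k"
    using Jpow_mult[of "s * x" i "u * y" j k] assms(3) by (simp add: ac_simps)
  ultimately show ?thesis unfolding saturated_power_def using W_mult by blast
qed

lemma Jsat_mult_left: "x \<in> Jsat n \<Longrightarrow> y * x \<in> Jsat n"
  using Jsat_mult[of y 0 x n n] by simp

lemma Jsat_add:
  assumes "x \<in> Jsat n" "y \<in> Jsat n"
  shows "x + y \<in> Jsat n"
proof -
  obtain s u where su: "s \<in> W" "u \<in> W" "s * x \<in> Jpow n" "u * y \<in> Jpow n"
    using assms unfolding saturated_power_def by blast
  have "u * (s * x) + s * (u * y) \<in> Jpow n" using su by (blast intro: Jpow_simps(2)[OF Jpow_simps(3) Jpow_simps(3)])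
  hence "(s * u) * (x + y) \<in> Jpow n" by (simp add: algebra_simps)
  thus ?thesis unfolding saturated_power_def using su W_mult by blast
qed

lemma Jsat_diff: "x \<in> Jsat n \<Longrightarrow> y \<in> Jsat n \<Longrightarrow> x - y \<in> Jsat n"
  using Jsat_add[of x n "(-1) * y"] Jsat_mult_left[of y n "-1"] by simp

lemma Jsat_sum: "(\<And>x. x \<in> C \<Longrightarrow> g x \<in> Jsat n) \<Longrightarrow> sum g C \<in> Jsat n"
  by (induction C rule: infinite_finite_induct)
    (simp_all add: Jsat_add Jpow_subset_Jsat[OF Jpow_simps(1)])

text \<open>A family of Hasse derivations is encoded as a ring homomorphism
  \<open>g \<mapsto> g + g\<^sub>1 T + g\<^sub>2 T\<^sup>2 + \<dots>\<close>. Its multiplicativity is the Leibniz rule, so that passing to \<open>g\<^sub>k\<close> costs at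
  most \<open>k\<close> factors from \<open>J\<close>.\<close>

lemma hasse_Jpow:
  fixes \<tau> :: "'a \<Rightarrow> 'a poly"
  assumes mult: "\<And>x y. \<tau> (x * y) = \<tau> x * \<tau> y" and add: "\<And>x y. \<tau> (x + y) = \<tau> x + \<tau> y"
    and id: "\<And>x. Polynomial.coeff (\<tau> x) 0 = x"
  shows "g \<in> Jpow N \<Longrightarrow> Polynomial.coeff (\<tau> g) k \<in> Jpow (N - k)"
proof (induction N arbitrary: g k)
  case (Suc N)
  from Suc.prems show ?case
  proof (induction rule: ideal_power_Suc_induct)
    case (prod x y)
    have "Polynomial.coeff (\<tau> x) i * Polynomial.coeff (\<tau> y) (k - i) \<in> Jpow (Suc N - k)" if "i \<le> k" for i
    proof (cases "i = k")
      case True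
      thus ?thesis
        using Jpow_mult[OF Suc.IH[OF prod(1), of k], of y 1] prod(2) by (simp add: id)
    next
      case False
      thus ?thesis using that Suc.IH[OF prod(1), of i]
        by (intro Jpow_simps(4)) (erule Jpow_antimono, simp)
    qed
    thus ?case unfolding mult Polynomial.coeff_mult
      by (intro ideal_ring_on_sum[OF ideal_Jpow]) auto
  next
    case (sum x y)
    thus ?case by (auto simp: add intro: Jpow_simps(2))
  qed
qed simp

text \<open>Given \<open>s g \<in> J\<^sup>N\<close>, the product \<open>s g\<^sub>k\<close> differs from \<open>(s g)\<^sub>k\<close> by terms that involve
  only \<open>g\<^sub>i\<close> with \<open>i < k\<close>, so induction on \<open>k\<close> applies and \<open>s\<close> can be cancelled.\<close>

lemma hasse_Jsat:
  fixes \<tau> :: "'a \<Rightarrow> 'a poly"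
  assumes mult: "\<And>x y. \<tau> (x * y) = \<tau> x * \<tau> y" and add: "\<And>x y. \<tau> (x + y) = \<tau> x + \<tau> y"
    and id: "\<And>x. Polynomial.coeff (\<tau> x) 0 = x"
    and g: "g \<in> Jsat N"
  shows "Polynomial.coeff (\<tau> g) k \<in> Jsat (N - k)"
proof -
  obtain s where s: "s \<in> W" "s * g \<in> Jpow N" using g unfolding saturated_power_def by blast
  show ?thesis
  proof (induction k rule: less_induct)
    case (less k)
    have "Polynomial.coeff (\<tau> (s * g)) k =
        (\<Sum>i\<le>k. Polynomial.coeff (\<tau> g) i * Polynomial.coeff (\<tau> s) (k - i))"
      by (simp add: mult mult.commute[of "\<tau> s"] Polynomial.coeff_mult)
    also have "{..k} = insert k {..<k}" by auto
    also have "(\<Sum>i\<in>insert k {..<k}. Polynomial.coeff (\<tau> g) i * Polynomial.coeff (\<tau> s) (k - i)) =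
        s * Polynomial.coeff (\<tau> g) k + (\<Sum>i<k. Polynomial.coeff (\<tau> g) i * Polynomial.coeff (\<tau> s) (k - i))"
      by (simp add: id mult.commute)
    finally have eq: "s * Polynomial.coeff (\<tau> g) k = Polynomial.coeff (\<tau> (s * g)) k -
        (\<Sum>i<k. Polynomial.coeff (\<tau> g) i * Polynomial.coeff (\<tau> s) (k - i))" by simp
    have "Polynomial.coeff (\<tau> (s * g)) k \<in> Jsat (N - k)"
      by (intro Jpow_subset_Jsat hasse_Jpow mult add id s)
    moreover have "Polynomial.coeff (\<tau> g) i * Polynomial.coeff (\<tau> s) (k - i) \<in> Jsat (N - k)" if "i < k" for i
      by (rule Jsat_mult[OF less[OF that], of _ 0]) (use that in auto)
    ultimately have "s * Polynomial.coeff (\<tau> g) k \<in> Jsat (N - k)"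
      unfolding eq by (intro Jsat_diff Jsat_sum) auto
    thus ?case by (rule Jsat_saturated[OF s(1)])
  qed
qed

end

lemma binomial_prime_power:
  fixes x y :: "'a::comm_ring_1"
  assumes "Factorial_Ring.prime p"
  obtains z where "(x + y) ^ p = x ^ p + y ^ p + of_nat p * (x * z)"
proof
  have p: "p > 1" using assms by (rule prime_gt_1_nat)
  define b where "b = (\<lambda>k. of_nat (p choose k) * x ^ k * y ^ (p - k))"
  have "{..p} = insert 0 (insert p {0<..<p})" using p by auto
  hence "(x + y) ^ p = b 0 + (b p + (\<Sum>k\<in>{0<..<p}. b k))"
    using p unfolding binomial_ring b_def[symmetric] by simp
  also have "(\<Sum>k\<in>{0<..<p}. b k) =
      (\<Sum>k\<in>{0<..<p}. of_nat p * (x * (of_nat ((p choose k) div p) * x ^ (k - 1) * y ^ (p - k))))"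
  proof (rule sum.cong)
    fix k assume k: "k \<in> {0<..<p}"
    hence "p dvd (p choose k)" using assms p by (intro dvd_choose_prime) auto
    hence "of_nat (p choose k) = of_nat p * (of_nat ((p choose k) div p) :: 'a)"
      by (metis dvd_mult_div_cancel of_nat_mult)
    moreover have "x ^ k = x * x ^ (k - 1)" using k by (simp add: power_eq_if)
    ultimately show "b k = of_nat p * (x * (of_nat ((p choose k) div p) * x ^ (k - 1) * y ^ (p - k)))"
      by (simp add: b_def ac_simps)
  qed simp
  finally show "(x + y) ^ p = x ^ p + y ^ p + of_nat p *
      (x * (\<Sum>k\<in>{0<..<p}. of_nat ((p choose k) div p) * x ^ (k - 1) * y ^ (p - k)))"
    by (simp add: b_def sum_distrib_left)
qed

text \<open>The two identities of the next lemma say that the lift of Frobenius is additive and multiplicative; they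
  are the source of the twisted Leibniz rule and of the defect of additivity of \<open>\<delta>\<close>.\<close>

lemma p_derivation_hom:
  assumes "p_derivation p \<delta>"
  shows "(x + y) ^ p + of_nat p * \<delta> (x + y) = (x ^ p + of_nat p * \<delta> x) + (y ^ p + of_nat p * \<delta> y)"
    and "(x * y) ^ p + of_nat p * \<delta> (x * y) = (x ^ p + of_nat p * \<delta> x) * (y ^ p + of_nat p * \<delta> y)"
  using assms unfolding p_derivation_def ring_hom_def by simp_all

lemma p_derivation_cancel:
  fixes x y :: "'a::comm_ring_1" and \<delta> :: "'a \<Rightarrow> 'a"
  assumes "p_derivation p \<delta>" "of_nat p * x = of_nat p * y"
  shows "x = y"
proof -
  have "of_nat p * (x - y) = 0" using assms(2) by (simp add: right_diff_distrib)
  hence "x - y = 0" using assms(1) unfolding p_derivation_def by blast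
  thus ?thesis by simp
qed

lemma p_derivation_mult:
  assumes "p_derivation p \<delta>"
  shows "\<delta> (x * y) = x ^ p * \<delta> y + \<delta> x * (y ^ p + of_nat p * \<delta> y)"
proof (rule p_derivation_cancel[OF assms])
  show "of_nat p * \<delta> (x * y) = of_nat p * (x ^ p * \<delta> y + \<delta> x * (y ^ p + of_nat p * \<delta> y))"
    using p_derivation_hom(2)[OF assms, of x y] by (simp add: algebra_simps)
qed

text \<open>Only the shape of the defect matters: it is a multiple of \<open>x\<close>, so it lies in every ideal
  that contains \<open>x\<close>.\<close>

lemma p_derivation_add:
  assumes "p_derivation p \<delta>" "Factorial_Ring.prime p"
  obtains z where "\<delta> (x + y) = \<delta> x + \<delta> y + x * z"
proof -
  obtain z where z: "(x + y) ^ p = x ^ p + y ^ p + of_nat p * (x * z)"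
    using binomial_prime_power[OF assms(2)] .
  have "of_nat p * \<delta> (x + y) = of_nat p * (\<delta> x + \<delta> y + x * (- z))"
    using p_derivation_hom(1)[OF assms(1), of x y] by (simp add: algebra_simps z)
  from p_derivation_cancel[OF assms(1) this] show thesis by (rule that)
qed

context saturated_ideal
begin

context
  fixes p :: nat and \<delta> :: "'a \<Rightarrow> 'a"
  assumes p: "Factorial_Ring.prime p" and pd: "p_derivation p \<delta>" and pJ: "of_nat p \<in> J"
begin

private lemma power_in: "x \<in> Jpow n \<Longrightarrow> x ^ p \<in> Jpow n"
  using prime_gt_0_nat[OF p] Jpow_simps(4)[of x n "x ^ (p - 1)"] by (simp add: power_eq_if)

private lemma frobenius_J: "x \<in> J \<Longrightarrow> x ^ p + of_nat p * \<delta> x \<in> J"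
  using Jpow_simps(2)[OF power_in[of x "Suc 0"] Jpow_simps(4)[of "of_nat p" "Suc 0"]] pJ by simp

text \<open>In \<open>\<delta>(x y) = x\<^sup>p \<delta>(y) + \<delta>(x) \<phi>(y)\<close> with \<open>x \<in> J\<^sup>n\<close> and \<open>y \<in> J\<close>, the loss of one factor in \<open>\<delta>(x)\<close> is made
  up by \<open>\<phi>(y) = y\<^sup>p + p \<delta>(y) \<in> J\<close>. This is where \<open>p \<in> J\<close> enters.\<close>

lemma p_derivation_Jpow: "x \<in> Jpow (Suc n) \<Longrightarrow> \<delta> x \<in> Jpow n"
proof (induction n arbitrary: x)
  case (Suc n)
  from Suc.prems show ?case
  proof (induction rule: ideal_power_Suc_induct)
    case (prod x y)
    have "\<delta> x * (y ^ p + of_nat p * \<delta> y) \<in> Jpow (Suc n)"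
      by (rule Jpow_mult[of _ n _ 1]) (use Suc.IH prod frobenius_J in auto)
    moreover have "x ^ p * \<delta> y \<in> Jpow (Suc n)"
      by (rule Jpow_simps(4)[OF power_in[OF prod(1)]])
    ultimately show ?case unfolding p_derivation_mult[OF pd] by (rule Jpow_simps(2)[rotated])
  next
    case (sum x y)
    obtain z where z: "\<delta> (x + y) = \<delta> x + \<delta> y + x * z" by (rule p_derivation_add[OF pd p])
    have "x * z \<in> Jpow (Suc n)"
      by (rule Jpow_simps(4)[OF Jpow_antimono[OF sum(1)]]) simp
    thus ?case unfolding z by (intro Jpow_simps(2)[OF Jpow_simps(2)] sum)
  qed
qed simp

private lemma frobenius_Jpow: "x \<in> Jpow n \<Longrightarrow> x ^ p + of_nat p * \<delta> x \<in> Jpow n"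
proof (cases n)
  case (Suc k)
  assume "x \<in> Jpow n"
  moreover from this have "of_nat p * \<delta> x \<in> Jpow n"
    using Jpow_mult[of "of_nat p" 1 "\<delta> x" k n] p_derivation_Jpow[of x k] Suc pJ by simp
  ultimately show ?thesis by (rule Jpow_simps(2)[OF power_in])
qed simp

text \<open>The lift of Frobenius \<open>\<phi>\<close> sends a denominator \<open>s\<close> to \<open>s\<^sup>p + p \<delta>(s)\<close>, which need not be in \<open>W\<close>,
  so \<open>\<phi>(s) \<phi>(x) \<in> J\<^sup>n\<close> does not settle the matter. But \<open>\<phi>(s)\<close> agrees with \<open>s\<^sup>p \<in> W\<close> up to a multiple of
  \<open>p \<in> J\<close>: once \<open>\<phi>(x)\<close> lies in the saturation of \<open>J\<^sup>k\<close> with \<open>k < n\<close>, the error \<open>p \<delta>(s) \<phi>(x)\<close> lies in that of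
  \<open>J\<^sup>k\<^sup>+\<^sup>1\<close>, and so does \<open>\<phi>(x)\<close>.\<close>

lemma frobenius_Jsat:
  assumes "x \<in> Jsat n"
  shows "x ^ p + of_nat p * \<delta> x \<in> Jsat n"
proof -
  define \<phi> where "\<phi> = (\<lambda>x. x ^ p + of_nat p * \<delta> x)"
  obtain s where s: "s \<in> W" "s * x \<in> Jpow n" using assms unfolding saturated_power_def by blast
  have sp: "s ^ k \<in> W" for k by (induction k) (auto intro: W_1 W_mult s)
  have sx: "\<phi> s * \<phi> x \<in> Jsat n"
    using frobenius_Jpow[OF s(2)] unfolding p_derivation_hom(2)[OF pd] \<phi>_def by (rule Jpow_subset_Jsat)
  have "k \<le> n \<Longrightarrow> \<phi> x \<in> Jsat k" for k
  proof (induction k)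
    case (Suc k)
    have "of_nat p * \<phi> x \<in> Jsat (Suc k)"
      by (rule Jsat_mult[of _ 1 _ k]) (use Suc pJ in auto)
    hence "\<phi> s * \<phi> x - \<delta> s * (of_nat p * \<phi> x) \<in> Jsat (Suc k)"
      by (rule Jsat_diff[OF Jsat_antimono[OF sx Suc.prems] Jsat_mult_left])
    also have "\<phi> s * \<phi> x - \<delta> s * (of_nat p * \<phi> x) = s ^ p * \<phi> x" by (simp add: \<phi>_def algebra_simps)
    finally show ?case by (rule Jsat_saturated[OF sp])
  qed simp
  thus ?thesis unfolding \<phi>_def by blast
qed

lemma p_derivation_Jsat:
  assumes "x \<in> Jsat (Suc n)"
  shows "\<delta> x \<in> Jsat n"
proof -
  obtain s where s: "s \<in> W" "s * x \<in> Jpow (Suc n)" using assms unfolding saturated_power_def by blast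
  have sp: "s ^ k \<in> W" for k by (induction k) (auto intro: W_1 W_mult s)
  have "\<delta> (s * x) - \<delta> s * (x ^ p + of_nat p * \<delta> x) \<in> Jsat n"
    by (intro Jsat_diff Jsat_mult_left frobenius_Jsat Jsat_antimono[OF assms]
        Jpow_subset_Jsat[OF p_derivation_Jpow[OF s(2)]]) simp
  hence "s ^ p * \<delta> x \<in> Jsat n" by (simp add: p_derivation_mult[OF pd])
  thus ?thesis by (rule Jsat_saturated[OF sp])
qed

end

end

section \<open>Homomorphisms out of a polynomial ring\<close>

lemma sum_single_keys:
  fixes P :: "'k \<Rightarrow>\<^sub>0 'a::comm_monoid_add"
  shows "(\<Sum>u\<in>Poly_Mapping.keys P. Poly_Mapping.single u (Poly_Mapping.lookup P u)) = P"
  by (rule poly_mapping_eqI)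
    (auto simp: lookup_sum lookup_single when_def not_in_keys_iff_lookup_eq_zero)

lemma poly_mapping_additive_induct [case_names zero single add]:
  fixes P :: "'k \<Rightarrow>\<^sub>0 'a::comm_monoid_add"
  assumes "Q 0" "\<And>u a. Q (Poly_Mapping.single u a)" "\<And>x y. Q x \<Longrightarrow> Q y \<Longrightarrow> Q (x + y)"
  shows "Q P"
proof -
  have "Q (\<Sum>u\<in>C. Poly_Mapping.single u (Poly_Mapping.lookup P u))" for C
    by (induction C rule: infinite_finite_induct) (use assms in auto)
  thus ?thesis by (metis sum_single_keys)
qed

text \<open>The additive map that applies \<open>c\<close> to the coefficients and \<open>e\<close> to the monomials. If \<open>c\<close> and \<open>e\<close> are
  multiplicative, this is the universal property of the monoid algebra; the lift of Frobenius, the Taylor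
  expansion and the constant coefficient are all instances.\<close>

definition eval_monoms :: "('a::comm_ring_1 \<Rightarrow> 'b::comm_ring_1) \<Rightarrow> ('k::comm_monoid_add \<Rightarrow> 'b) \<Rightarrow> ('k \<Rightarrow>\<^sub>0 'a) \<Rightarrow> 'b" where
  "eval_monoms c e P = (\<Sum>u\<in>Poly_Mapping.keys P. c (Poly_Mapping.lookup P u) * e u)"

locale eval_hom =
  fixes c :: "'a::comm_ring_1 \<Rightarrow> 'b::comm_ring_1" and e :: "'k::comm_monoid_add \<Rightarrow> 'b"
  assumes c_add: "c (x + y) = c x + c y" and c_mult: "c (x * y) = c x * c y"
    and e_add: "e (u + v) = e u * e v"
begin

lemma c_0: "c 0 = 0"
  using c_add[of 0 0] by simp

lemma eval_superset:
  assumes "finite C" "Poly_Mapping.keys P \<subseteq> C"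
  shows "eval_monoms c e P = (\<Sum>u\<in>C. c (Poly_Mapping.lookup P u) * e u)"
  unfolding eval_monoms_def
  by (rule sum.mono_neutral_left) (use assms in \<open>auto simp: c_0 not_in_keys_iff_lookup_eq_zero\<close>)

lemma eval_0: "eval_monoms c e 0 = 0"
  by (simp add: eval_monoms_def)

lemma eval_single: "eval_monoms c e (Poly_Mapping.single u a) = c a * e u"
  by (subst eval_superset[of "{u}"]) auto

lemma eval_add: "eval_monoms c e (P + Q) = eval_monoms c e P + eval_monoms c e Q"
proof -
  have "finite (Poly_Mapping.keys P \<union> Poly_Mapping.keys Q)" by simp
  note sup = eval_superset[OF this]
  show ?thesis
    using keys_add[of P Q] by (simp add: sup lookup_add c_add distrib_right sum.distrib)
qed

lemma eval_mult: "eval_monoms c e (P * Q) = eval_monoms c e P * eval_monoms c e Q"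
proof (induction P rule: poly_mapping_additive_induct)
  case (single u a)
  show ?case
    by (induction Q rule: poly_mapping_additive_induct)
      (simp_all add: eval_0 eval_single mult_single c_mult e_add distrib_left distrib_right eval_add ac_simps)
qed (simp_all add: eval_0 eval_add distrib_right)

end

lemma lookup_const_mult:
  fixes P :: "'k::comm_monoid_add \<Rightarrow>\<^sub>0 'a::comm_semiring_1"
  shows "Poly_Mapping.lookup (Poly_Mapping.single 0 a * P) u = a * Poly_Mapping.lookup P u"
proof (induction P rule: poly_mapping_additive_induct)
  case (single v b)
  thus ?case by (simp add: mult_single lookup_single when_def)
qed (simp_all add: lookup_add distrib_left)

lemma lookup_of_nat_mult:
  fixes P :: "'k::comm_monoid_add \<Rightarrow>\<^sub>0 'a::comm_semiring_1"
  shows "Poly_Mapping.lookup (of_nat n * P) u = of_nat n * Poly_Mapping.lookup P u"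
  using lookup_const_mult[of "of_nat n" P u] by simp

lemma keys_add_nat: "Poly_Mapping.keys (u + v) = Poly_Mapping.keys u \<union> Poly_Mapping.keys v"
  for u v :: "'k \<Rightarrow>\<^sub>0 nat"
  by (auto simp: in_keys_iff lookup_add)

lemma add_eq_0_nat: "u + v = 0 \<longleftrightarrow> u = 0 \<and> v = 0" for u v :: "'k \<Rightarrow>\<^sub>0 nat"
  by (auto simp: poly_mapping_eq_iff fun_eq_iff lookup_add)

lemma lookup_0_mult:
  fixes P Q :: "'a::comm_ring_1 mpolynomial"
  shows "Poly_Mapping.lookup (P * Q) 0 = Poly_Mapping.lookup P 0 * Poly_Mapping.lookup Q 0"
proof -
  interpret eval_hom "\<lambda>a. a :: 'a" "\<lambda>u :: nat \<Rightarrow>\<^sub>0 nat. if u = 0 then 1 else 0"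
    by unfold_locales (auto simp: add_eq_0_nat)
  have "eval_monoms (\<lambda>a. a) (\<lambda>u. if u = 0 then 1 else 0) P = Poly_Mapping.lookup P 0" for P :: "'a mpolynomial"
    by (induction P rule: poly_mapping_additive_induct)
      (auto simp: eval_0 eval_single eval_add lookup_single lookup_add when_def)
  thus ?thesis using eval_mult[of P Q] by simp
qed

lemma lookup_0_power:
  fixes P :: "'a::comm_ring_1 mpolynomial"
  shows "Poly_Mapping.lookup (P ^ n) 0 = Poly_Mapping.lookup P 0 ^ n"
  by (induction n) (simp_all add: lookup_0_mult)

subsection \<open>Extending a \<open>p\<close>-derivation\<close>


text \<open>The lift of Frobenius extends by \<open>x\<^sub>i \<mapsto> x\<^sub>i\<^sup>p\<close>. It agrees with the \<open>p\<close>-th power modulo \<open>p\<close> on monomials with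
  coefficients, hence everywhere because \<open>p\<close>-th powers are additive modulo \<open>p\<close>. Setting all variables to \<open>0\<close> commutes
  with it, which gives the formula for the constant coefficient.\<close>

lemma p_derivation_mpolynomial:
  fixes \<delta>\<^sub>0 :: "'a::comm_ring_1 \<Rightarrow> 'a"
  assumes p: "Factorial_Ring.prime p" and pd: "p_derivation p \<delta>\<^sub>0"
  obtains \<delta> :: "'a mpolynomial \<Rightarrow> 'a mpolynomial" where "p_derivation p \<delta>"
    "\<And>P. Poly_Mapping.lookup (\<delta> P) 0 = \<delta>\<^sub>0 (Poly_Mapping.lookup P 0)"
proof -
  define \<phi>\<^sub>0 where "\<phi>\<^sub>0 = (\<lambda>x. x ^ p + of_nat p * \<delta>\<^sub>0 x)"
  define e :: "(nat \<Rightarrow>\<^sub>0 nat) \<Rightarrow> 'a mpolynomial" where "e = (\<lambda>u. Poly_Mapping.single (of_nat p * u) 1)"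
  interpret eval_hom "\<lambda>a. mconst (\<phi>\<^sub>0 a)" e
    by unfold_locales
      (use p_derivation_hom[OF pd] in \<open>auto simp: mconst_def \<phi>\<^sub>0_def e_def mult_single distrib_left simp flip: single_add\<close>)
  define \<phi> where "\<phi> = eval_monoms (\<lambda>a. mconst (\<phi>\<^sub>0 a)) e"
  have p0: "p > 0" using p by (rule prime_gt_0_nat)
  have \<phi>_single: "\<phi> (Poly_Mapping.single u a) = Poly_Mapping.single (of_nat p * u) (\<phi>\<^sub>0 a)" for u a
    unfolding \<phi>_def eval_single by (simp add: mconst_def e_def mult_single)
  have single_power: "Poly_Mapping.single u a ^ n = Poly_Mapping.single (of_nat n * u) (a ^ n)"
    for u :: "nat \<Rightarrow>\<^sub>0 nat" and a :: 'a and n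
    by (induction n) (simp_all add: mult_single distrib_right)
  have "of_nat p dvd \<phi> P - P ^ p" for P
  proof (induction P rule: poly_mapping_additive_induct)
    case zero thus ?case using p0 by (simp add: \<phi>_def eval_0 power_0_left)
  next
    case (single u a)
    have "\<phi> (Poly_Mapping.single u a) - Poly_Mapping.single u a ^ p =
        Poly_Mapping.single 0 (of_nat p) * Poly_Mapping.single (of_nat p * u) (\<delta>\<^sub>0 a)"
      by (simp only: \<phi>_single single_power mult_single) (simp add: \<phi>\<^sub>0_def flip: single_diff)
    thus ?case by (simp add: single_of_nat)
  next
    case (add x y)
    obtain z where z: "(x + y) ^ p = x ^ p + y ^ p + of_nat p * (x * z)"
      using binomial_prime_power[OF p] .
    have "\<phi> (x + y) - (x + y) ^ p = (\<phi> x - x ^ p) + (\<phi> y - y ^ p) - of_nat p * (x * z)"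
      by (simp add: z \<phi>_def eval_add)
    thus ?case using add by simp
  qed
  hence "\<exists>z. \<phi> P = P ^ p + of_nat p * z" for P
    by (metis add.commute diff_eq_eq dvdE)
  then obtain \<delta> where \<delta>: "\<phi> P = P ^ p + of_nat p * \<delta> P" for P by metis
  have 1: "p_derivation p \<delta>"
    unfolding p_derivation_def
  proof (intro conjI allI impI ring_hom_memI)
    fix P :: "'a mpolynomial" assume "of_nat p * P = 0"
    hence "of_nat p * Poly_Mapping.lookup P u = 0" for u
      using lookup_of_nat_mult[of p P u] by simp
    hence "Poly_Mapping.lookup P u = 0" for u using pd unfolding p_derivation_def by blast
    thus "P = 0" by (intro poly_mapping_eqI) simp
  next
    have "\<phi>\<^sub>0 1 = 1" using pd unfolding p_derivation_def ring_hom_def \<phi>\<^sub>0_def by simp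
    hence "\<phi> 1 = 1" using \<phi>_single[of 0 1] by simp
    hence "1 ^ p + of_nat p * \<delta> 1 = 1" by (subst (asm) \<delta>)
    thus "\<one>\<^bsub>ring_on UNIV\<^esub> ^ p + of_nat p * \<delta> \<one>\<^bsub>ring_on UNIV\<^esub> = \<one>\<^bsub>ring_on UNIV\<^esub>"
      by simp
  qed (simp_all add: \<phi>_def eval_add eval_mult flip: \<delta>)
  have 2: "Poly_Mapping.lookup (\<delta> P) 0 = \<delta>\<^sub>0 (Poly_Mapping.lookup P 0)" for P
  proof (rule p_derivation_cancel[OF pd])
    have pu: "of_nat p * u = 0 \<longleftrightarrow> u = 0" for u :: "nat \<Rightarrow>\<^sub>0 nat"
      using p0 by (auto simp: poly_mapping_eq_iff fun_eq_iff lookup_of_nat_mult)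
    have \<phi>\<^sub>0_add: "\<phi>\<^sub>0 (a + b) = \<phi>\<^sub>0 a + \<phi>\<^sub>0 b" for a b
      using p_derivation_hom(1)[OF pd] by (simp add: \<phi>\<^sub>0_def)
    have \<phi>\<^sub>0_0: "\<phi>\<^sub>0 0 = 0" using \<phi>\<^sub>0_add[of 0 0] by simp
    have "Poly_Mapping.lookup (\<phi> P) 0 = \<phi>\<^sub>0 (Poly_Mapping.lookup P 0)"
    proof (induction P rule: poly_mapping_additive_induct)
      case zero
      thus ?case by (simp add: \<phi>_def eval_0 \<phi>\<^sub>0_0)
    next
      case (single u a)
      thus ?case by (simp add: \<phi>_single lookup_single when_def pu \<phi>\<^sub>0_0) (use p0 in simp)
    next
      case (add x y)
      thus ?case by (simp add: \<phi>_def eval_add lookup_add \<phi>\<^sub>0_add)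
    qed
    hence "Poly_Mapping.lookup (P ^ p + of_nat p * \<delta> P) 0 = \<phi>\<^sub>0 (Poly_Mapping.lookup P 0)"
      unfolding \<delta> .
    thus "of_nat p * Poly_Mapping.lookup (\<delta> P) 0 = of_nat p * \<delta>\<^sub>0 (Poly_Mapping.lookup P 0)"
      by (simp add: \<phi>\<^sub>0_def lookup_add lookup_0_power lookup_of_nat_mult)
  qed
  from 1 2 show thesis by (rule that)
qed

subsection \<open>Taylor expansion in one variable\<close>

text \<open>The homomorphism \<open>x\<^sub>i \<mapsto> x\<^sub>i + T\<close> that fixes the other variables: the factor with exponent
  \<open>update i 0 u\<close> carries the other variables of the monomial \<open>x\<^sup>u\<close>. The coefficients at \<open>T\<^sup>k\<close> are the Hasse
  derivatives with respect to \<open>x\<^sub>i\<close>.\<close>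

definition taylor :: "nat \<Rightarrow> 'a::comm_ring_1 mpolynomial \<Rightarrow> 'a mpolynomial poly" where
  "taylor i = eval_monoms (\<lambda>a. [:mconst a:])
     (\<lambda>u. [:Poly_Mapping.single (Poly_Mapping.update i 0 u) 1:] *
           [:Poly_Mapping.single (Poly_Mapping.single i 1) 1, 1:] ^ Poly_Mapping.lookup u i)"

lemma update_0_add: "Poly_Mapping.update i 0 (u + v) = Poly_Mapping.update i 0 u + Poly_Mapping.update i 0 v"
  by (rule poly_mapping_eqI) (simp add: lookup_add lookup_update)

lemma taylor_eval_hom:
  "eval_hom (\<lambda>a :: 'a::comm_ring_1. [:mconst a:])
     (\<lambda>u. [:Poly_Mapping.single (Poly_Mapping.update i 0 u) 1:] *
           [:Poly_Mapping.single (Poly_Mapping.single i 1) 1, 1:] ^ Poly_Mapping.lookup u i)"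
proof unfold_locales
  fix u v :: "nat \<Rightarrow>\<^sub>0 nat"
  let ?X = "\<lambda>u. [:Poly_Mapping.single (Poly_Mapping.update i 0 u) (1::'a):]"
  have "?X (u + v) = ?X u * ?X v" by (simp add: update_0_add mult_single add.commute)
  thus "?X (u + v) * [:Poly_Mapping.single (Poly_Mapping.single i 1) 1, 1:] ^ Poly_Mapping.lookup (u + v) i =
      (?X u * [:Poly_Mapping.single (Poly_Mapping.single i 1) 1, 1:] ^ Poly_Mapping.lookup u i) *
      (?X v * [:Poly_Mapping.single (Poly_Mapping.single i 1) 1, 1:] ^ Poly_Mapping.lookup v i)"
    by (simp only: lookup_add power_add ac_simps)
qed (simp_all add: mconst_def mult_single single_add mult.commute)

lemmas taylor_add = eval_hom.eval_add[OF taylor_eval_hom, folded taylor_def]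
lemmas taylor_mult = eval_hom.eval_mult[OF taylor_eval_hom, folded taylor_def]
lemmas taylor_0 = eval_hom.eval_0[OF taylor_eval_hom, folded taylor_def]

lemma coeff_taylor_single:
  "Polynomial.coeff (taylor i (Poly_Mapping.single u (a::'a::comm_ring_1))) k =
     of_nat (Poly_Mapping.lookup u i choose k) *
     Poly_Mapping.single (Poly_Mapping.update i (Poly_Mapping.lookup u i - k) u) a"
proof -
  let ?n = "Poly_Mapping.lookup u i" and ?x = "Poly_Mapping.single (Poly_Mapping.single i (1::nat)) (1::'a)"
  have "Polynomial.coeff (taylor i (Poly_Mapping.single u a)) k =
      Poly_Mapping.single (Poly_Mapping.update i 0 u) a * Polynomial.coeff ([:?x, 1:] ^ ?n) k"
    unfolding taylor_def eval_hom.eval_single[OF taylor_eval_hom]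
    by (simp add: mconst_def mult_single mult.assoc[symmetric])
  also have "\<dots> = of_nat (?n choose k) *
      Poly_Mapping.single (Poly_Mapping.update i (?n - k) u) a"
  proof (cases "k \<le> ?n")
    case True
    have x: "?x ^ j = Poly_Mapping.single (Poly_Mapping.single i j) 1" for j
      by (induction j) (simp_all add: mult_single flip: single_add)
    have "Poly_Mapping.update i 0 u + Poly_Mapping.single i (?n - k) = Poly_Mapping.update i (?n - k) u"
      by (rule poly_mapping_eqI) (simp add: lookup_add lookup_update lookup_single when_def)
    thus ?thesis using True
      by (simp add: coeff_linear_poly_power x[simplified] mult_single ac_simps mult.left_commute)
  next
    case False
    have "Polynomial.degree ([:?x, 1:] ^ ?n) \<le> ?n"
      using degree_power_le[of "[:?x, 1:]" ?n] by simp
    hence "Polynomial.coeff ([:?x, 1:] ^ ?n) k = 0" using False by (intro Polynomial.coeff_eq_0) linarith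
    thus ?thesis using False by (simp add: binomial_eq_0)
  qed
  finally show ?thesis .
qed

lemma coeff_taylor_0: "Polynomial.coeff (taylor i P) 0 = P"
proof (induction P rule: poly_mapping_additive_induct)
  case (single u a)
  have "Poly_Mapping.update i (Poly_Mapping.lookup u i) u = u"
    by (rule poly_mapping_eqI) (simp add: lookup_update)
  thus ?case by (simp add: coeff_taylor_single)
qed (simp_all add: taylor_0 taylor_add)

text \<open>At exponents without \<open>x\<^sub>i\<close> the binomial factor of the Hasse derivative is \<open>1\<close>.\<close>

lemma lookup_coeff_taylor:
  assumes "Poly_Mapping.lookup v i = 0"
  shows "Poly_Mapping.lookup (Polynomial.coeff (taylor i P) k) v =
    Poly_Mapping.lookup P (v + Poly_Mapping.single i k)"
proof (induction P rule: poly_mapping_additive_induct)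
  case (single u a)
  have "Poly_Mapping.update i (Poly_Mapping.lookup u i - k) u = v \<longleftrightarrow>
      Poly_Mapping.lookup u i \<le> k \<and> (\<forall>j. j \<noteq> i \<longrightarrow> Poly_Mapping.lookup u j = Poly_Mapping.lookup v j)"
    using assms by (auto simp: poly_mapping_eq_iff fun_eq_iff lookup_update)
  moreover have "u = v + Poly_Mapping.single i k \<longleftrightarrow>
      Poly_Mapping.lookup u i = k \<and> (\<forall>j. j \<noteq> i \<longrightarrow> Poly_Mapping.lookup u j = Poly_Mapping.lookup v j)"
    using assms by (auto simp: poly_mapping_eq_iff fun_eq_iff lookup_add lookup_single when_def)
  ultimately show ?case
    by (auto simp: coeff_taylor_single lookup_of_nat_mult lookup_single when_def binomial_eq_0)
qed (simp_all add: taylor_0 taylor_add lookup_add)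

section \<open>Gradings\<close>

lemma monom_degree_superset:
  assumes "finite C" "Poly_Mapping.keys u \<subseteq> C"
  shows "monom_degree w u = (\<Sum>i\<in>C. w i * Poly_Mapping.lookup u i)"
  unfolding monom_degree_def
  by (rule sum.mono_neutral_left) (use assms in \<open>auto simp: not_in_keys_iff_lookup_eq_zero\<close>)

lemma monom_degree_add: "monom_degree w (u + v) = monom_degree w u + monom_degree w v"
proof -
  have "finite (Poly_Mapping.keys u \<union> Poly_Mapping.keys v)" by simp
  note sup = monom_degree_superset[OF this]
  show ?thesis by (simp add: sup keys_add_nat lookup_add distrib_left sum.distrib)
qed

lemma monom_degree_0 [simp]: "monom_degree w 0 = 0"
  by (simp add: monom_degree_def)

lemma monom_degree_single: "monom_degree w (Poly_Mapping.single i k) = w i * k"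
  by (subst monom_degree_superset[of "{i}"]) auto

definition restrict_keys :: "'k set \<Rightarrow> ('k \<Rightarrow>\<^sub>0 'a::comm_monoid_add) \<Rightarrow> ('k \<Rightarrow>\<^sub>0 'a)" where
  "restrict_keys C P = (\<Sum>u\<in>Poly_Mapping.keys P \<inter> C. Poly_Mapping.single u (Poly_Mapping.lookup P u))"

lemma lookup_restrict_keys:
  "Poly_Mapping.lookup (restrict_keys C P) u = (if u \<in> C then Poly_Mapping.lookup P u else 0)"
  unfolding restrict_keys_def
  by (auto simp: lookup_sum lookup_single when_def not_in_keys_iff_lookup_eq_zero)

lemma restrict_keys_0 [simp]: "restrict_keys C 0 = 0"
  by (simp add: restrict_keys_def)

lemma restrict_keys_add: "restrict_keys C (P + Q) = restrict_keys C P + restrict_keys C Q"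
  by (rule poly_mapping_eqI) (simp add: lookup_restrict_keys lookup_add)

lemma restrict_keys_single:
  "restrict_keys C (Poly_Mapping.single u a) = (if u \<in> C then Poly_Mapping.single u a else 0)"
  by (rule poly_mapping_eqI) (simp add: lookup_restrict_keys lookup_single when_def)

lemma restrict_keys_eq: "Poly_Mapping.keys P \<subseteq> C \<Longrightarrow> restrict_keys C P = P"
  by (rule poly_mapping_eqI) (auto simp: lookup_restrict_keys not_in_keys_iff_lookup_eq_zero)

lemma restrict_keys_mult:
  fixes P Q :: "'k::comm_monoid_add \<Rightarrow>\<^sub>0 'a::comm_ring_1"
  assumes "\<And>u v. u + v \<in> C \<longleftrightarrow> u \<in> C \<and> v \<in> C"
  shows "restrict_keys C (P * Q) = restrict_keys C P * restrict_keys C Q"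
proof (induction P rule: poly_mapping_additive_induct)
  case (single u a)
  show ?case
    by (induction Q rule: poly_mapping_additive_induct)
      (simp_all add: restrict_keys_single restrict_keys_add mult_single assms distrib_left)
qed (simp_all add: restrict_keys_add distrib_right)

definition component :: "(nat \<Rightarrow> nat) \<Rightarrow> nat \<Rightarrow> 'a::comm_monoid_add mpolynomial \<Rightarrow> 'a mpolynomial" where
  "component w j = restrict_keys {u. monom_degree w u = j}"

lemma component_mult:
  fixes P Q :: "'a::comm_ring_1 mpolynomial"
  shows "component w j (P * Q) = (\<Sum>i\<le>j. component w i P * component w (j - i) Q)"
proof (induction P rule: poly_mapping_additive_induct)
  case (single u a)
  show ?case
  proof (induction Q rule: poly_mapping_additive_induct)
    case (single v b)
    have "(\<Sum>i\<le>j. component w i (Poly_Mapping.single u a) * component w (j - i) (Poly_Mapping.single v b)) =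
        (\<Sum>i\<le>j. if i = monom_degree w u then (if monom_degree w v = j - i
           then Poly_Mapping.single (u + v) (a * b) else 0) else 0)"
      by (intro sum.cong) (auto simp: component_def restrict_keys_single mult_single)
    also have "\<dots> = component w j (Poly_Mapping.single u a * Poly_Mapping.single v b)"
      by (auto simp: component_def restrict_keys_single mult_single monom_degree_add)
    finally show ?case by simp
  qed (simp_all add: component_def restrict_keys_add distrib_left sum.distrib)
qed (simp_all add: component_def restrict_keys_add distrib_right sum.distrib)

lemma component_homog:
  assumes "P \<in> homog w i"
  shows "component w j P = (if i = j then P else 0)"
  by (rule poly_mapping_eqI)
    (use assms in \<open>auto simp: component_def lookup_restrict_keys homog_def in_keys_iff\<close>)

lemma sum_components:
  fixes P :: "'a::comm_monoid_add mpolynomial"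
  obtains C where "finite C" "P = (\<Sum>j\<in>C. component w j P)"
proof
  show "finite (monom_degree w ` Poly_Mapping.keys P)" by simp
  show "P = (\<Sum>j\<in>monom_degree w ` Poly_Mapping.keys P. component w j P)"
    by (rule poly_mapping_eqI)
      (auto simp: lookup_sum component_def lookup_restrict_keys in_keys_iff)
qed

section \<open>Coefficients of elements of symbolic powers\<close>

text \<open>Since the lift of Frobenius fixes integers, \<open>p \<delta>(p\<^sup>c u) = p\<^sup>c (u\<^sup>p + p \<delta>(u)) - p\<^sup>c\<^sup>p u\<^sup>p\<close> with \<open>c = b + 1\<close>, and
  \<open>c p > c\<close>. So \<open>\<delta>\<close> removes exactly one factor \<open>p\<close>, and replaces \<open>u\<close> by \<open>u\<^sup>p\<close> modulo \<open>p\<close>.\<close>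

lemma p_derivation_power_mult:
  fixes \<delta> :: "'a::comm_ring_1 \<Rightarrow> 'a"
  assumes p: "Factorial_Ring.prime p" and pd: "p_derivation p \<delta>"
  obtains v where "\<delta> (of_nat p ^ Suc b * u) = of_nat p ^ b * (u ^ p + of_nat p * v)"
proof -
  define \<phi> where "\<phi> = (\<lambda>x. x ^ p + of_nat p * \<delta> x)"
  have \<phi>_add: "\<phi> (x + y) = \<phi> x + \<phi> y" and \<phi>_mult: "\<phi> (x * y) = \<phi> x * \<phi> y" for x y
    using p_derivation_hom[OF pd] by (simp_all add: \<phi>_def)
  have "\<phi> 0 = 0" using \<phi>_add[of 0 0] by simp
  moreover have \<phi>1: "\<phi> 1 = 1" using pd unfolding p_derivation_def ring_hom_def \<phi>_def by simp
  ultimately have nat: "\<phi> (of_nat n) = of_nat n" for n by (induction n) (simp_all add: \<phi>_add)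
  have "\<phi> (of_nat p ^ n) = of_nat p ^ n" for n by (induction n) (simp_all add: \<phi>_mult \<phi>1 nat)
  hence eq: "\<phi> (of_nat p ^ Suc b * u) = of_nat p ^ Suc b * (u ^ p + of_nat p * \<delta> u)"
    by (simp only: \<phi>_mult) (simp only: \<phi>_def)
  have "p > 1" using p by (rule prime_gt_1_nat)
  then obtain k where k: "p = Suc (Suc k)" by (metis less_imp_Suc_add plus_1_eq_Suc One_nat_def add_Suc)
  have "Suc b * p = Suc b + (Suc (b + Suc b * k))" by (simp add: k)
  hence pp: "(of_nat p ^ Suc b :: 'a) ^ p = of_nat p ^ (Suc b + Suc (b + Suc b * k))"
    by (simp only: power_mult[symmetric])
  have pw: "(of_nat p ^ Suc b * u) ^ p = of_nat p ^ Suc b * (of_nat p * (of_nat p ^ (b + Suc b * k) * u ^ p))"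
    unfolding power_mult_distrib pp by (simp only: power_add power_Suc mult.assoc)
  have "of_nat p * \<delta> (of_nat p ^ Suc b * u) =
      of_nat p ^ Suc b * (u ^ p + of_nat p * \<delta> u) - (of_nat p ^ Suc b * u) ^ p"
    using eq by (simp add: \<phi>_def algebra_simps)
  also have "\<dots> = of_nat p * (of_nat p ^ b * (u ^ p + of_nat p * (\<delta> u - of_nat p ^ (b + Suc b * k) * u ^ p)))"
    unfolding pw by (simp add: algebra_simps)
  finally show thesis by (rule that[OF p_derivation_cancel[OF pd]])
qed

locale saturated_mpolynomial_ideal = saturated_ideal J W for J W :: "'a::comm_ring_1 mpolynomial set" +
  fixes p :: nat and \<delta>\<^sub>0 :: "'a \<Rightarrow> 'a"
  assumes p: "Factorial_Ring.prime p" and pd: "p_derivation p \<delta>\<^sub>0"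
    and radical: "\<And>x :: 'a. of_nat p dvd x ^ p \<Longrightarrow> of_nat p dvd x"
    and p_in_J: "of_nat p \<in> J"
    and J_const: "\<And>g. g \<in> J \<Longrightarrow> of_nat p dvd Poly_Mapping.lookup g 0"
begin

text \<open>Taking constant coefficients commutes with \<open>\<delta>\<close>. After \<open>b\<close> applications of \<open>\<delta>\<close> one is left with
  an element of \<open>J\<close> whose constant coefficient is a power of \<open>u\<close> modulo \<open>p\<close>.\<close>

lemma const_coefficient_of_Jsat:
  assumes "g \<in> Jsat (Suc b)" "Poly_Mapping.lookup g 0 = of_nat p ^ b * u"
  shows "of_nat p dvd u"
proof -
  obtain \<delta> :: "'a mpolynomial \<Rightarrow> 'a mpolynomial" where \<delta>: "p_derivation p \<delta>"
      "Poly_Mapping.lookup (\<delta> P) 0 = \<delta>\<^sub>0 (Poly_Mapping.lookup P 0)" for P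
    using p_derivation_mpolynomial[OF p pd] by blast
  show ?thesis using assms
  proof (induction b arbitrary: g u)
    case 0
    thus ?case using J_const[of g] by simp
  next
    case (Suc b)
    obtain v where v: "\<delta>\<^sub>0 (of_nat p ^ Suc b * u) = of_nat p ^ b * (u ^ p + of_nat p * v)"
      using p_derivation_power_mult[OF p pd] .
    have "of_nat p dvd u ^ p + of_nat p * v"
      by (rule Suc.IH[OF p_derivation_Jsat[OF p \<delta>(1) p_in_J Suc.prems(1)]])
        (simp only: \<delta>(2) Suc.prems(2) v)
    hence "of_nat p dvd u ^ p" by (simp add: dvd_add_left_iff)
    thus ?case by (rule radical)
  qed
qed

text \<open>Take the Hasse derivative of order \<open>\<alpha>\<^sub>i\<close> in one variable \<open>x\<^sub>i\<close> of \<open>x\<^sup>\<alpha>\<close> after the other. Each step removes a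
  variable from \<open>\<alpha>\<close>, whence the induction on the number of its variables.\<close>

lemma coefficient_to_const_coefficient:
  assumes "g \<in> Jsat N"
  obtains g' where "g' \<in> Jsat (N - monom_degree (\<lambda>_. 1) \<alpha>)"
    "Poly_Mapping.lookup g' 0 = Poly_Mapping.lookup g \<alpha>"
proof -
  have "\<exists>g'\<in>Jsat (N - monom_degree (\<lambda>_. 1) \<alpha>). Poly_Mapping.lookup g' 0 = Poly_Mapping.lookup g \<alpha>"
    using assms
  proof (induction "card (Poly_Mapping.keys \<alpha>)" arbitrary: \<alpha> g N rule: less_induct)
    case less
    show ?case
    proof (cases "\<alpha> = 0")
      case True thus ?thesis using less.prems by auto
    next
      case False
      then obtain i where i: "i \<in> Poly_Mapping.keys \<alpha>" by (metis equals0I keys_eq_empty)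
      define k where "k = Poly_Mapping.lookup \<alpha> i"
      define \<alpha>' where "\<alpha>' = Poly_Mapping.update i 0 \<alpha>"
      have \<alpha>: "\<alpha> = \<alpha>' + Poly_Mapping.single i k"
        by (rule poly_mapping_eqI) (simp add: \<alpha>'_def k_def lookup_add lookup_update lookup_single when_def)
      have "Poly_Mapping.keys \<alpha>' = Poly_Mapping.keys \<alpha> - {i}"
        by (auto simp: \<alpha>'_def in_keys_iff lookup_update split: if_splits)
      hence card: "card (Poly_Mapping.keys \<alpha>') < card (Poly_Mapping.keys \<alpha>)"
        using card_Diff1_less[OF finite_keys i] by simp
      have deg: "monom_degree (\<lambda>_. 1) \<alpha> = monom_degree (\<lambda>_. 1) \<alpha>' + k"
        by (subst \<alpha>) (simp add: monom_degree_add monom_degree_single)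
      have "Polynomial.coeff (taylor i g) k \<in> Jsat (N - k)"
        by (rule hasse_Jsat) (use less.prems in \<open>simp_all add: taylor_mult taylor_add coeff_taylor_0\<close>)
      from less.hyps[OF card this] obtain g' where "g' \<in> Jsat (N - k - monom_degree (\<lambda>_. 1) \<alpha>')"
        "Poly_Mapping.lookup g' 0 = Poly_Mapping.lookup (Polynomial.coeff (taylor i g) k) \<alpha>'" by blast
      moreover have "Poly_Mapping.lookup (Polynomial.coeff (taylor i g) k) \<alpha>' = Poly_Mapping.lookup g \<alpha>"
        by (subst lookup_coeff_taylor) (simp_all add: \<alpha>'_def lookup_update \<alpha>[unfolded \<alpha>'_def, symmetric])
      ultimately show ?thesis unfolding deg by (metis diff_diff_left add.commute)
    qed
  qed
  thus thesis using that by blast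
qed

lemma coefficient_of_Jsat:
  assumes "g \<in> Jsat N" "b + monom_degree (\<lambda>_. 1) \<alpha> < N" "Poly_Mapping.lookup g \<alpha> = of_nat p ^ b * u"
  shows "of_nat p dvd u"
proof -
  obtain g' where g': "g' \<in> Jsat (N - monom_degree (\<lambda>_. 1) \<alpha>)"
      "Poly_Mapping.lookup g' 0 = Poly_Mapping.lookup g \<alpha>"
    using coefficient_to_const_coefficient[OF assms(1)] .
  show ?thesis
    by (rule const_coefficient_of_Jsat[OF Jsat_antimono[OF g'(1)]]) (use assms g' in auto)
qed

end

section \<open>The base ring\<close>

text \<open>Fermat's little theorem makes the identity of \<open>\<int>\<close> a lift of Frobenius.\<close>

lemma prime_dvd_diff_power_int:
  fixes p :: nat
  assumes p: "Factorial_Ring.prime p"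
  shows "int p dvd k - k ^ p"
proof -
  have step: "int p dvd (k + 1) - (k + 1) ^ p \<longleftrightarrow> int p dvd k - k ^ p" for k
  proof -
    obtain z where z: "(k + 1) ^ p = k ^ p + 1 ^ p + int p * (k * z)"
      using binomial_prime_power[OF p] .
    have "(k + 1) - (k + 1) ^ p = (k - k ^ p) + int p * (- (k * z))" by (simp add: z)
    thus ?thesis by (simp only: dvd_add_left_iff dvd_triv_left)
  qed
  show ?thesis
  proof (induction k rule: int_induct[of _ 0])
    case base thus ?case using prime_gt_0_nat[OF p] by (simp add: power_0_left)
  next
    case (step1 i) thus ?case using step[of i] by simp
  next
    case (step2 i) thus ?case using step[of "i - 1"] by simp
  qed
qed

lemma p_derivation_int:
  fixes p :: nat
  assumes p: "Factorial_Ring.prime p" and A: "ring_on (UNIV :: 'a::idom set) \<simeq> int_ring"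
  shows "\<exists>\<delta> :: 'a \<Rightarrow> 'a. p_derivation p \<delta>" and "of_nat p dvd (x :: 'a) ^ n \<Longrightarrow> of_nat p dvd x"
proof -
  obtain h where h: "h \<in> ring_iso (ring_on (UNIV :: 'a set)) int_ring"
    using A unfolding is_ring_iso_def by blast
  have add: "h (x + y) = h x + h y" and mult: "h (x * y) = h x * h y" and one: "h 1 = 1"
    and bij: "bij h" for x y
    using h by (auto simp: ring_iso_def ring_hom_def)
  have inj: "h x = h y \<longleftrightarrow> x = y" for x y using bij by (simp add: bij_def inj_eq)
  have zero: "h 0 = 0" using add[of 0 0] by simp
  have nat: "h (of_nat n) = int n" for n by (induction n) (simp_all add: zero add one)
  have pow: "h (x ^ n) = h x ^ n" for x n by (induction n) (simp_all add: mult one)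
  have dvd: "of_nat p dvd x \<longleftrightarrow> int p dvd h x" for x
  proof
    assume "of_nat p dvd x"
    thus "int p dvd h x" by (auto simp: dvd_def mult nat)
  next
    assume "int p dvd h x"
    then obtain z where "h x = int p * z" by blast
    moreover obtain y where "z = h y" using bij by (metis bij_pointE)
    ultimately have "h x = h (of_nat p * y)" by (simp add: mult nat)
    thus "of_nat p dvd x" by (simp add: inj)
  qed
  have p0: "p > 0" using p by (rule prime_gt_0_nat)
  have "\<exists>d. x = x ^ p + of_nat p * d" for x :: 'a
  proof -
    have "h (x - x ^ p) = h x - h x ^ p" using add[of "x - x ^ p" "x ^ p"] by (simp add: pow)
    hence "of_nat p dvd x - x ^ p" using prime_dvd_diff_power_int[OF p, of "h x"] by (simp add: dvd)
    then obtain d where "x - x ^ p = of_nat p * d" by blast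
    thus ?thesis by (intro exI[of _ d]) (simp add: algebra_simps)
  qed
  then obtain \<delta> :: "'a \<Rightarrow> 'a" where \<delta>: "x ^ p + of_nat p * \<delta> x = x" for x by metis
  have cancel: "x = 0" if "of_nat p * x = 0" for x :: 'a
  proof -
    have "int p * h x = h (of_nat p * x)" by (simp add: mult nat)
    also have "\<dots> = h 0" by (rule arg_cong[OF that])
    finally have "int p * h x = h 0" .
    thus ?thesis using p0 inj[of x 0] by (simp add: zero)
  qed
  have "p_derivation p \<delta>"
    unfolding p_derivation_def \<delta>
  proof (intro conjI allI impI)
    show "x = 0" if "of_nat p * x = 0" for x :: 'a using that by (rule cancel)
    show "(\<lambda>x. x) \<in> ring_hom (ring_on (UNIV :: 'a set)) (ring_on UNIV)" by (rule ring_hom_memI) simp_all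
  qed
  thus "\<exists>\<delta> :: 'a \<Rightarrow> 'a. p_derivation p \<delta>" by blast
  have "Factorial_Ring.prime (int p)" using p by simp
  thus "of_nat p dvd x ^ n \<Longrightarrow> of_nat p dvd x"
    unfolding dvd pow by (rule prime_dvd_power)
qed

lemma cgenideal_ring_on: "PIdl\<^bsub>ring_on K\<^esub> x = {y * x | y. y \<in> K}"
  by (simp add: cgenideal_def)

lemma dvd_power_uniformizer:
  fixes x :: "'a::idom"
  assumes "uniformizer (ring_on (UNIV :: 'a set)) u" "u dvd x ^ n"
  shows "u dvd x"
proof -
  interpret cring "ring_on (UNIV :: 'a set)" by (rule cring_ring_on_UNIV)
  have dvd: "u dvd y \<longleftrightarrow> y \<in> PIdl\<^bsub>ring_on UNIV\<^esub> u" for y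
    by (auto simp: cgenideal_ring_on dvd_def mult.commute)
  have prime: "primeideal (PIdl\<^bsub>ring_on UNIV\<^esub> u) (ring_on UNIV)"
    using assms(1) maximalideal_prime unfolding uniformizer_def by blast
  show ?thesis using assms(2)
  proof (induction n)
    case 0
    hence "u dvd y" for y using dvd_trans[of u 1 y] by simp
    hence "PIdl\<^bsub>ring_on UNIV\<^esub> u = carrier (ring_on UNIV)" by (auto simp flip: dvd)
    thus ?case using primeideal.I_notcarr[OF prime] by simp
  next
    case (Suc n)
    thus ?case using primeideal.I_prime[OF prime, of x "x ^ n"] by (auto simp: dvd)
  qed
qed

section \<open>Lifting a splitting modulo \<open>p\<close>\<close>

lemma mem_coset_ring_on:
  "y \<in> I +>\<^bsub>ring_on K\<^esub> a \<longleftrightarrow> (\<exists>i\<in>I. y = i + a)"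
  by (auto simp: a_r_coset_def')

lemma coset_ring_on_eq_iff:
  assumes K: "cring (ring_on K)" and I: "ideal I (ring_on K)" and "a \<in> K" "b \<in> K"
  shows "I +>\<^bsub>ring_on K\<^esub> a = I +>\<^bsub>ring_on K\<^esub> b \<longleftrightarrow> a - b \<in> I"
proof
  assume "I +>\<^bsub>ring_on K\<^esub> a = I +>\<^bsub>ring_on K\<^esub> b"
  moreover have "a \<in> I +>\<^bsub>ring_on K\<^esub> a"
    using ideal_ring_onD(2)[OF I] by (force simp: mem_coset_ring_on)
  ultimately show "a - b \<in> I" by (auto simp: mem_coset_ring_on)
next
  assume ab: "a - b \<in> I"
  have "i + a = (i + (a - b)) + b" "i + b = (i - (a - b)) + a" for i by simp_all
  thus "I +>\<^bsub>ring_on K\<^esub> a = I +>\<^bsub>ring_on K\<^esub> b"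
    using ideal_ring_onD(3)[OF I _ ab] ideal_ring_on_diff[OF K I _ ab]
    by (intro Set.set_eqI) (metis mem_coset_ring_on)
qed

lemma quot_map_coset:
  assumes L: "cring (ring_on L)" and "K \<subseteq> L" "0 \<in> K"
  shows "quot_map (ring_on L) x (PIdl\<^bsub>ring_on K\<^esub> x +>\<^bsub>ring_on K\<^esub> r) = PIdl\<^bsub>ring_on L\<^esub> x +>\<^bsub>ring_on L\<^esub> r"
proof (intro Set.set_eqI iffI)
  fix y assume "y \<in> quot_map (ring_on L) x (PIdl\<^bsub>ring_on K\<^esub> x +>\<^bsub>ring_on K\<^esub> r)"
  then obtain a b where "a \<in> L" "b \<in> K" "y = a * x + (b * x + r)"
    by (auto simp: quot_map_def set_add_def' cgenideal_ring_on mem_coset_ring_on)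
  moreover from this have "y = (a + b) * x + r" "a + b \<in> L"
    using assms ring_on_closed(3)[OF L, of a b] by (auto simp: algebra_simps)
  ultimately show "y \<in> PIdl\<^bsub>ring_on L\<^esub> x +>\<^bsub>ring_on L\<^esub> r"
    unfolding cgenideal_ring_on mem_coset_ring_on by blast
next
  fix y assume "y \<in> PIdl\<^bsub>ring_on L\<^esub> x +>\<^bsub>ring_on L\<^esub> r"
  then obtain a where a: "a \<in> L" "y = a * x + r" by (auto simp: cgenideal_ring_on mem_coset_ring_on)
  have "r \<in> PIdl\<^bsub>ring_on K\<^esub> x +>\<^bsub>ring_on K\<^esub> r"
    using assms(3) by (force simp: cgenideal_ring_on mem_coset_ring_on)
  thus "y \<in> quot_map (ring_on L) x (PIdl\<^bsub>ring_on K\<^esub> x +>\<^bsub>ring_on K\<^esub> r)"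
    using a by (auto simp: quot_map_def set_add_def' cgenideal_ring_on)
qed

lemma FactRing_ring_on:
  assumes K: "cring (ring_on K)" and I: "ideal I (ring_on K)"
  shows "carrier (ring_on K Quot I) = (\<lambda>a. I +>\<^bsub>ring_on K\<^esub> a) ` K"
    and "a \<in> K \<Longrightarrow> b \<in> K \<Longrightarrow> (I +>\<^bsub>ring_on K\<^esub> a) \<oplus>\<^bsub>ring_on K Quot I\<^esub> (I +>\<^bsub>ring_on K\<^esub> b) = I +>\<^bsub>ring_on K\<^esub> (a + b)"
    and "a \<in> K \<Longrightarrow> b \<in> K \<Longrightarrow> (I +>\<^bsub>ring_on K\<^esub> a) \<otimes>\<^bsub>ring_on K Quot I\<^esub> (I +>\<^bsub>ring_on K\<^esub> b) = I +>\<^bsub>ring_on K\<^esub> (a * b)"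
proof -
  interpret ideal I "ring_on K" by fact
  show "carrier (ring_on K Quot I) = (\<lambda>a. I +>\<^bsub>ring_on K\<^esub> a) ` K"
    by (auto simp: FactRing_def A_RCOSETS_def')
  show "a \<in> K \<Longrightarrow> b \<in> K \<Longrightarrow> (I +>\<^bsub>ring_on K\<^esub> a) \<oplus>\<^bsub>ring_on K Quot I\<^esub> (I +>\<^bsub>ring_on K\<^esub> b) = I +>\<^bsub>ring_on K\<^esub> (a + b)"
    using a_rcos_sum[of a b] by (simp add: FactRing_def)
  show "a \<in> K \<Longrightarrow> b \<in> K \<Longrightarrow> (I +>\<^bsub>ring_on K\<^esub> a) \<otimes>\<^bsub>ring_on K Quot I\<^esub> (I +>\<^bsub>ring_on K\<^esub> b) = I +>\<^bsub>ring_on K\<^esub> (a * b)"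
    using rcoset_mult_add[of a b] by (simp add: FactRing_def)
qed

text \<open>The splitting \<open>\<beta>\<close> is replaced by a map \<open>b\<close> on representatives, which is linear only
  modulo \<open>x\<close>, so that cosets need not be mentioned further on.\<close>

lemma graded_direct_summand_mod_lift:
  fixes K L :: "'a::comm_ring_1 set"
  assumes K: "cring (ring_on K)" and L: "cring (ring_on L)" and KL: "K \<subseteq> L" and x: "x \<in> K"
    and summand: "graded_direct_summand_mod (ring_on K) (ring_on L) G x"
  obtains b where "\<And>s. s \<in> L \<Longrightarrow> b s \<in> K"
    "\<And>s s'. s \<in> L \<Longrightarrow> s' \<in> L \<Longrightarrow> b (s + s') - (b s + b s') \<in> PIdl\<^bsub>ring_on K\<^esub> x"
    "\<And>r s. r \<in> K \<Longrightarrow> s \<in> L \<Longrightarrow> b (r * s) - r * b s \<in> PIdl\<^bsub>ring_on K\<^esub> x"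
    "\<And>r. r \<in> K \<Longrightarrow> b r - r \<in> PIdl\<^bsub>ring_on K\<^esub> x"
    "\<And>d s. s \<in> G d \<Longrightarrow> s \<in> L \<Longrightarrow> \<exists>r \<in> G d \<inter> K. b s - r \<in> PIdl\<^bsub>ring_on K\<^esub> x"
    "K \<inter> PIdl\<^bsub>ring_on L\<^esub> x \<subseteq> PIdl\<^bsub>ring_on K\<^esub> x"
proof -
  interpret k: cring "ring_on K" by fact
  interpret l: cring "ring_on L" by fact
  define IK where "IK = PIdl\<^bsub>ring_on K\<^esub> x"
  define IL where "IL = PIdl\<^bsub>ring_on L\<^esub> x"
  have IK: "ideal IK (ring_on K)" using x unfolding IK_def by (intro k.cgenideal_ideal) simp
  have IL: "ideal IL (ring_on L)" using x KL unfolding IL_def by (intro l.cgenideal_ideal) auto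
  note FK = FactRing_ring_on[OF K IK] and FL = FactRing_ring_on[OF L IL]
  note eqK = coset_ring_on_eq_iff[OF K IK] and eqL = coset_ring_on_eq_iff[OF L IL]
  note Kc = ring_on_closed[OF K] and Lc = ring_on_closed[OF L]
  define cK where "cK = (\<lambda>a. IK +>\<^bsub>ring_on K\<^esub> a)"
  define cL where "cL = (\<lambda>a. IL +>\<^bsub>ring_on L\<^esub> a)"
  have \<iota>: "quot_map (ring_on L) x (cK r) = cL r" for r
    using quot_map_coset[OF L KL Kc(1)] unfolding cK_def cL_def IK_def IL_def .
  have inj: "inj_on (quot_map (ring_on L) x) (cK ` K)"
    and ex: "\<exists>\<beta> \<in> cL ` L \<rightarrow> cK ` K.
      (\<forall>a \<in> cL ` L. \<forall>b \<in> cL ` L. \<beta> (a \<oplus>\<^bsub>ring_on L Quot IL\<^esub> b) = \<beta> a \<oplus>\<^bsub>ring_on K Quot IK\<^esub> \<beta> b) \<and>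
      (\<forall>r \<in> cK ` K. \<forall>a \<in> cL ` L. \<beta> (quot_map (ring_on L) x r \<otimes>\<^bsub>ring_on L Quot IL\<^esub> a) =
         r \<otimes>\<^bsub>ring_on K Quot IK\<^esub> \<beta> a) \<and>
      (\<forall>r \<in> cK ` K. \<beta> (quot_map (ring_on L) x r) = r) \<and>
      (\<forall>d. \<forall>s \<in> G d \<inter> L. \<exists>r \<in> G d \<inter> K. \<beta> (cL s) = cK r)"
    using summand
    unfolding graded_direct_summand_mod_def Let_def IK_def[symmetric] IL_def[symmetric] FK(1) FL(1)
      cK_def[symmetric] cL_def[symmetric] by simp_all
  from ex obtain \<beta> where \<beta>: "\<beta> \<in> cL ` L \<rightarrow> cK ` K" and props:
      "(\<forall>a \<in> cL ` L. \<forall>b \<in> cL ` L. \<beta> (a \<oplus>\<^bsub>ring_on L Quot IL\<^esub> b) = \<beta> a \<oplus>\<^bsub>ring_on K Quot IK\<^esub> \<beta> b) \<and>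
      (\<forall>r \<in> cK ` K. \<forall>a \<in> cL ` L. \<beta> (quot_map (ring_on L) x r \<otimes>\<^bsub>ring_on L Quot IL\<^esub> a) =
         r \<otimes>\<^bsub>ring_on K Quot IK\<^esub> \<beta> a) \<and>
      (\<forall>r \<in> cK ` K. \<beta> (quot_map (ring_on L) x r) = r) \<and>
      (\<forall>d. \<forall>s \<in> G d \<inter> L. \<exists>r \<in> G d \<inter> K. \<beta> (cL s) = cK r)"
    by (rule bexE)
  note \<beta>_add = props[THEN conjunct1, rule_format]
    and \<beta>_mult = props[THEN conjunct2, THEN conjunct1, rule_format]
    and \<beta>_id = props[THEN conjunct2, THEN conjunct2, THEN conjunct1, rule_format]
    and \<beta>_grade = props[THEN conjunct2, THEN conjunct2, THEN conjunct2, rule_format, OF IntI]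
  have "\<exists>r\<in>K. \<beta> (cL s) = cK r" if "s \<in> L" for s using \<beta> that by blast
  then obtain b where b: "\<And>s. s \<in> L \<Longrightarrow> b s \<in> K" "\<And>s. s \<in> L \<Longrightarrow> \<beta> (cL s) = cK (b s)" by metis
  show thesis
  proof (rule that[of b, folded IK_def IL_def])
    show "s \<in> L \<Longrightarrow> b s \<in> K" for s by (rule b)
    show "b (s + s') - (b s + b s') \<in> IK" if s: "s \<in> L" "s' \<in> L" for s s'
    proof -
      have "cK (b (s + s')) = cK (b s + b s')"
        using \<beta>_add[of "cL s" "cL s'"] s b Lc by (simp add: FL(2) FK(2) cK_def cL_def)
      thus ?thesis using eqK s b Lc Kc unfolding cK_def by simp
    qed
    show "b (r * s) - r * b s \<in> IK" if s: "r \<in> K" "s \<in> L" for r s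
    proof -
      have rs: "r \<in> L" "r * s \<in> L" using s KL Lc by auto
      have "cK (b (r * s)) = cK (r * b s)"
        using \<beta>_mult[of "cK r" "cL s"] s rs b unfolding \<iota> by (simp add: FL(3) FK(3) cK_def cL_def)
      thus ?thesis using eqK s rs b Kc unfolding cK_def by simp
    qed
    show "b r - r \<in> IK" if r: "r \<in> K" for r
    proof -
      have "r \<in> L" using r KL by auto
      moreover have "cK (b r) = cK r" using \<beta>_id[of "cK r"] r \<open>r \<in> L\<close> b unfolding \<iota> by simp
      ultimately show ?thesis using eqK r b unfolding cK_def by simp
    qed
    show "\<exists>r \<in> G d \<inter> K. b s - r \<in> IK" if s: "s \<in> G d" "s \<in> L" for d s
      using \<beta>_grade[OF s] b s eqK unfolding cK_def by auto
    show "K \<inter> IL \<subseteq> IK"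
    proof
      fix r assume r: "r \<in> K \<inter> IL"
      hence "cL r = cL 0" using eqL[of r 0] KL Lc unfolding cL_def by auto
      hence "cK r = cK 0" using inj_onD[OF inj, of "cK r" "cK 0"] r Kc unfolding \<iota> by blast
      thus "r \<in> IK" using eqK r Kc unfolding cK_def by simp
    qed
  qed
qed

section \<open>Graded subalgebras\<close>

lemma cring_mpoly_in: "cring (ring_on (mpoly_in m :: 'a::comm_ring_1 mpolynomial set))"
proof (rule cring_ring_on)
  fix P Q :: "'a mpolynomial" assume PQ: "P \<in> mpoly_in m" "Q \<in> mpoly_in m"
  show "P + Q \<in> mpoly_in m" using PQ keys_add[of P Q] by (auto simp: mpoly_in_def)
  show "P * Q \<in> mpoly_in m"
    unfolding mpoly_in_def
  proof safe
    fix u i assume u: "u \<in> Poly_Mapping.keys (P * Q)" and i: "i \<in> Poly_Mapping.keys u"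
    from u keys_mult[of P Q] obtain a b where "a \<in> Poly_Mapping.keys P" "b \<in> Poly_Mapping.keys Q" "u = a + b"
      by blast
    thus "i < m" using PQ i by (auto simp: mpoly_in_def keys_add_nat)
  qed
next
  fix P :: "'a mpolynomial" assume "P \<in> mpoly_in m"
  thus "- P \<in> mpoly_in m" by (auto simp: mpoly_in_def in_keys_iff)
qed (simp add: mpoly_in_def)

lemma subalgebra_generated_induct [consumes 1, case_names const gen minus add mult]:
  assumes "x \<in> subalgebra_generated F" "\<And>a. P (mconst a)" "\<And>g. g \<in> F \<Longrightarrow> P g"
    "\<And>x. x \<in> subalgebra_generated F \<Longrightarrow> P x \<Longrightarrow> P (- x)"
    "\<And>x y. x \<in> subalgebra_generated F \<Longrightarrow> y \<in> subalgebra_generated F \<Longrightarrow> P x \<Longrightarrow> P y \<Longrightarrow> P (x + y)"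
    "\<And>x y. x \<in> subalgebra_generated F \<Longrightarrow> y \<in> subalgebra_generated F \<Longrightarrow> P x \<Longrightarrow> P y \<Longrightarrow> P (x * y)"
  shows "P x"
  using assms(1) unfolding subalgebra_generated_def
proof (induction rule: generate_ring.induct)
  case one
  have "P (mconst 1)" by (rule assms(2))
  thus ?case by (simp add: mconst_def)
next
  case (incl h) thus ?case using assms(2,3) by auto
next
  case (a_inv h)
  thus ?case using assms(4) ring_on_minus(2)[OF cring_ring_on_UNIV, of h] by (simp add: subalgebra_generated_def)
next
  case (eng_add h1 h2) thus ?case using assms(5) by (simp add: subalgebra_generated_def)
next
  case (eng_mult h1 h2) thus ?case using assms(6) by (simp add: subalgebra_generated_def)
qed

lemma subalgebra_generated_closed:
  shows mconst_in_subalgebra: "mconst a \<in> subalgebra_generated F"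
    and gen_in_subalgebra: "g \<in> F \<Longrightarrow> g \<in> subalgebra_generated F"
    and cring_subalgebra: "cring (ring_on (subalgebra_generated F))"
proof -
  show "mconst a \<in> subalgebra_generated F" "g \<in> F \<Longrightarrow> g \<in> subalgebra_generated F"
    unfolding subalgebra_generated_def by (auto intro: generate_ring.incl)
  show "cring (ring_on (subalgebra_generated F))"
  proof (rule cring_ring_on)
    show "1 \<in> subalgebra_generated F"
      using generate_ring.one[of "ring_on UNIV"] by (simp add: subalgebra_generated_def)
    fix x y assume x: "x \<in> subalgebra_generated F"
    show "- x \<in> subalgebra_generated F"
      using generate_ring.a_inv[OF x[unfolded subalgebra_generated_def]]
        ring_on_minus(2)[OF cring_ring_on_UNIV, of x] by (simp add: subalgebra_generated_def)
    assume y: "y \<in> subalgebra_generated F"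
    show "x + y \<in> subalgebra_generated F"
      using generate_ring.eng_add[OF x[unfolded subalgebra_generated_def] y[unfolded subalgebra_generated_def]]
      by (simp add: subalgebra_generated_def)
    show "x * y \<in> subalgebra_generated F"
      using generate_ring.eng_mult[OF x[unfolded subalgebra_generated_def] y[unfolded subalgebra_generated_def]]
      by (simp add: subalgebra_generated_def)
  qed
qed

lemma subalgebra_subset:
  assumes "F \<subseteq> mpoly_in m"
  shows "subalgebra_generated F \<subseteq> mpoly_in m"
proof
  fix x assume "x \<in> subalgebra_generated F"
  thus "x \<in> mpoly_in m"
  proof (induction rule: subalgebra_generated_induct)
    case (const a)
    show ?case by (simp add: mpoly_in_def mconst_def)
  qed (use assms ring_on_closed[OF cring_mpoly_in] ring_on_minus[OF cring_mpoly_in] in auto)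
qed

text \<open>The hypothesis \<open>k D < j + D\<close> means \<open>k \<le> \<lceil>j/D\<rceil>\<close>. The generators satisfy the claim because their degrees
  are at most \<open>D\<close>, and it passes to products because \<open>\<lceil>(i+j)/D\<rceil> \<le> \<lceil>i/D\<rceil> + \<lceil>j/D\<rceil>\<close>.\<close>

lemma component_in_ideal_power:
  fixes F :: "'a::comm_ring_1 mpolynomial set"
  assumes M: "ideal M (ring_on (subalgebra_generated F))" and FM: "F \<subseteq> M" and D: "D > 0"
    and homog: "\<And>g. g \<in> F \<Longrightarrow> \<exists>i>0. i \<le> D \<and> g \<in> homog w i"
    and r: "r \<in> subalgebra_generated F" and k: "k * D < j + D"
  shows "component w j r \<in> ideal_power (ring_on (subalgebra_generated F)) M k"
proof -
  let ?K = "subalgebra_generated F"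
  note K = cring_subalgebra[of F]
  note Mk = ideal_power_ideal[OF K M]
  show ?thesis using r k
  proof (induction arbitrary: j k rule: subalgebra_generated_induct)
    case (const a)
    have c: "mconst a \<in> homog w 0" by (simp add: homog_def mconst_def)
    show ?case
    proof (cases "j = 0")
      case True
      hence "k = 0" using const by (cases k) auto
      thus ?thesis using True mconst_in_subalgebra by (simp add: component_homog[OF c] ideal_power_0)
    qed (simp add: component_homog[OF c] ideal_ring_onD(2)[OF Mk])
  next
    case (gen g)
    obtain i where i: "i > 0" "i \<le> D" "g \<in> homog w i" using homog[OF gen(1)] by blast
    show ?case
    proof (cases "i = j")
      case True
      hence "k * D < 2 * D" using gen(2) i by linarith
      hence "k \<le> Suc 0" using D by simp
      moreover have "g \<in> ideal_power (ring_on ?K) M (Suc 0)"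
        using gen FM unfolding ideal_power_1[OF K M] by blast
      ultimately show ?thesis using True ideal_power_antimono[OF K M] by (auto simp: component_homog[OF i(3)])
    qed (simp add: component_homog[OF i(3)] ideal_ring_onD(2)[OF Mk])
  next
    case (minus x)
    have "component w j (- x) = 0 - component w j x"
      by (rule poly_mapping_eqI) (simp add: component_def lookup_restrict_keys lookup_minus)
    thus ?case using ideal_ring_on_diff[OF K Mk ideal_ring_onD(2)[OF Mk] minus(2)[OF minus(3)]] by simp
  next
    case (add x y)
    thus ?case using ideal_ring_onD(3)[OF Mk] by (simp add: component_def restrict_keys_add)
  next
    case (mult x y)
    \<comment> \<open>Round the degrees of both factors up to multiples of \<open>D\<close>.\<close>
    show ?case unfolding component_mult
    proof (rule ideal_ring_on_sum[OF Mk])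
      fix i assume "i \<in> {..j}"
      hence i: "i \<le> j" by simp
      define a b where "a = (i + D - 1) div D" and "b = (j - i + D - 1) div D"
      have round: "(n + D - 1) div D * D < n + D" "n \<le> (n + D - 1) div D * D" for n
      proof -
        have "(n + D - 1) div D * D + (n + D - 1) mod D = n + D - 1" by simp
        moreover have "(n + D - 1) mod D < D" using D by simp
        ultimately show "(n + D - 1) div D * D < n + D" "n \<le> (n + D - 1) div D * D" using D by linarith+
      qed
      have "k * D < (a + b) * D + D"
        using mult(5) i round(2)[of i] round(2)[of "j - i"] unfolding a_def b_def add_mult_distrib by linarith
      hence "k * D < (a + b + 1) * D" by simp
      hence "k \<le> a + b" using mult_less_cancel2[of k D "a + b + 1"] by linarith
      moreover have "component w i x * component w (j - i) y \<in> ideal_power (ring_on ?K) M (a + b)"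
        by (intro ideal_power_mult[OF K M] mult(3,4)) (use round in \<open>simp_all add: a_def b_def\<close>)
      ultimately show "component w i x * component w (j - i) y \<in> ideal_power (ring_on ?K) M k"
        using ideal_power_antimono[OF K M] by blast
    qed
  qed
qed

lemma dvd_lookup_imp_dvd:
  fixes P :: "'a::comm_ring_1 mpolynomial"
  assumes "\<And>u. c dvd Poly_Mapping.lookup P u" "P \<in> mpoly_in m"
  obtains Q where "Q \<in> mpoly_in m" "P = mconst c * Q"
proof -
  obtain q where q: "Poly_Mapping.lookup P u = c * q u" for u using assms(1) unfolding dvd_def by metis
  define Q where "Q = (\<Sum>u\<in>Poly_Mapping.keys P. Poly_Mapping.single u (q u))"
  have lookup_Q: "Poly_Mapping.lookup Q u = (if u \<in> Poly_Mapping.keys P then q u else 0)" for u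
    unfolding Q_def by (simp add: lookup_sum lookup_single when_def)
  show thesis
  proof
    show "Q \<in> mpoly_in m" using assms(2) by (auto simp: mpoly_in_def in_keys_iff lookup_Q split: if_splits)
    show "P = mconst c * Q"
      by (rule poly_mapping_eqI) (simp add: mconst_def lookup_const_mult lookup_Q q[symmetric] in_keys_iff)
  qed
qed

section \<open>The containment\<close>

text \<open>Composing with the retraction \<open>\<pi>\<close> that sends the variables \<open>x\<^sub>i\<close> with \<open>i \<ge> m\<close> to \<open>0\<close> extends the splitting to the
  polynomials in all variables, a ring that is a type and on which the operators of the previous sections act. The
  statement on constant coefficients is what remains of the grading: constants belong to \<open>K\<close> and
  are fixed modulo \<open>p\<close>, while all other monomials have positive degree and keep it.\<close>

lemma graded_direct_summand_mod_retraction: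
  fixes K :: "'a::comm_ring_1 mpolynomial set"
  assumes K: "cring (ring_on K)" and KL: "K \<subseteq> mpoly_in m" and const: "\<And>a. mconst a \<in> K"
    and w: "\<And>i. i < m \<Longrightarrow> w i > 0"
    and summand: "graded_direct_summand_mod (ring_on K) (ring_on (mpoly_in m)) (homog w) (of_nat p)"
  obtains b where "\<And>g. b g \<in> K"
    "\<And>g h. b (g + h) - (b g + b h) \<in> PIdl\<^bsub>ring_on K\<^esub> (of_nat p)"
    "\<And>r g. r \<in> K \<Longrightarrow> b (r * g) - r * b g \<in> PIdl\<^bsub>ring_on K\<^esub> (of_nat p)"
    "\<And>r. r \<in> K \<Longrightarrow> b r - r \<in> PIdl\<^bsub>ring_on K\<^esub> (of_nat p)"
    "\<And>g. of_nat p dvd Poly_Mapping.lookup (b g) 0 - Poly_Mapping.lookup g 0"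
    "K \<inter> PIdl\<^bsub>ring_on (mpoly_in m)\<^esub> (of_nat p) \<subseteq> PIdl\<^bsub>ring_on K\<^esub> (of_nat p)"
proof -
  let ?I = "PIdl\<^bsub>ring_on K\<^esub> (of_nat p)"
  have "of_nat p \<in> K" by (rule ring_on_closed[OF K])
  note lift = graded_direct_summand_mod_lift[OF K cring_mpoly_in KL this summand]
  obtain b where
      b: "\<And>s. s \<in> mpoly_in m \<Longrightarrow> b s \<in> K"
    and b_add: "\<And>s s'. s \<in> mpoly_in m \<Longrightarrow> s' \<in> mpoly_in m \<Longrightarrow> b (s + s') - (b s + b s') \<in> ?I"
    and b_mult: "\<And>r s. r \<in> K \<Longrightarrow> s \<in> mpoly_in m \<Longrightarrow> b (r * s) - r * b s \<in> ?I"
    and b_id: "\<And>r. r \<in> K \<Longrightarrow> b r - r \<in> ?I"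
    and b_homog: "\<And>d s. s \<in> homog w d \<Longrightarrow> s \<in> mpoly_in m \<Longrightarrow> \<exists>r \<in> homog w d \<inter> K. b s - r \<in> ?I"
    and pure: "K \<inter> PIdl\<^bsub>ring_on (mpoly_in m)\<^esub> (of_nat p) \<subseteq> ?I" 
    by (rule lift) (rule that)
  define \<pi> :: "'a mpolynomial \<Rightarrow> 'a mpolynomial" where "\<pi> = restrict_keys {u. Poly_Mapping.keys u \<subseteq> {..<m}}"
  have \<pi>_in: "\<pi> g \<in> mpoly_in m" for g
  proof -
    have "Poly_Mapping.keys u \<subseteq> {..<m}" if "u \<in> Poly_Mapping.keys (\<pi> g)" for u
      using that in_keys_iff[of u "\<pi> g"] by (auto simp: \<pi>_def lookup_restrict_keys split: if_splits)
    thus ?thesis unfolding mpoly_in_def by blast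
  qed
  have \<pi>_id: "\<pi> g = g" if "g \<in> mpoly_in m" for g
    using that unfolding \<pi>_def by (intro restrict_keys_eq) (auto simp: mpoly_in_def)
  have \<pi>_mult: "\<pi> (g * h) = \<pi> g * \<pi> h" for g h
    unfolding \<pi>_def by (intro restrict_keys_mult) (auto simp: keys_add_nat)
  have \<pi>_add: "\<pi> (g + h) = \<pi> g + \<pi> h" for g h unfolding \<pi>_def by (rule restrict_keys_add)
  have const_I: "of_nat p dvd Poly_Mapping.lookup y 0" if "y \<in> ?I" for y
  proof -
    from that obtain z where "y = z * of_nat p" by (auto simp: cgenideal_ring_on)
    hence "y = of_nat p * z" by (simp add: mult.commute)
    thus ?thesis by (simp add: lookup_of_nat_mult)
  qed
  have ct: "of_nat p dvd Poly_Mapping.lookup (b (\<pi> g)) 0 - Poly_Mapping.lookup g 0" for g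
  proof (induction g rule: poly_mapping_additive_induct)
    case zero
    show ?case using const_I[OF b_id[OF ring_on_closed(1)[OF K]]] by (simp add: \<pi>_def lookup_minus)
  next
    case (single u a)
    have K_case: ?case if "\<pi> (Poly_Mapping.single u a) \<in> K"
      "Poly_Mapping.lookup (\<pi> (Poly_Mapping.single u a)) 0 = Poly_Mapping.lookup (Poly_Mapping.single u a) 0"
      using const_I[OF b_id[OF that(1)]] that(2) by (simp add: lookup_minus)
    show ?case
    proof (cases "u = 0 \<or> \<not> Poly_Mapping.keys u \<subseteq> {..<m}")
      case True
      thus ?thesis
      proof
        assume "u = 0"
        thus ?thesis using const[of a] by (intro K_case) (simp_all add: \<pi>_def restrict_keys_single mconst_def)
      next
        assume "\<not> Poly_Mapping.keys u \<subseteq> {..<m}"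
        moreover from this have "u \<noteq> 0" by auto
        ultimately show ?thesis using ring_on_closed(1)[OF K]
          by (intro K_case) (simp_all add: \<pi>_def restrict_keys_single lookup_single when_def)
      qed
    next
      case False
      then obtain i where i: "i \<in> Poly_Mapping.keys u" "i < m" by (metis equals0I keys_eq_empty lessThan_iff subsetD)
      have "w i * Poly_Mapping.lookup u i \<le> monom_degree w u"
        unfolding monom_degree_def by (rule member_le_sum) (use i in auto)
      moreover have "w i * Poly_Mapping.lookup u i > 0" using i w by (auto simp: in_keys_iff)
      ultimately have deg: "monom_degree w u \<noteq> 0" by linarith
      have "Poly_Mapping.single u a \<in> homog w (monom_degree w u)" by (simp add: homog_def)
      moreover have "Poly_Mapping.single u a \<in> mpoly_in m" using False by (auto simp: mpoly_in_def)
      ultimately obtain r where r: "r \<in> homog w (monom_degree w u)" "b (Poly_Mapping.single u a) - r \<in> ?I"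
        using b_homog by blast
      have "Poly_Mapping.lookup r 0 = 0"
        using r(1) deg unfolding homog_def by (metis (mono_tags, lifting) in_keys_iff mem_Collect_eq monom_degree_0)
      thus ?thesis using const_I[OF r(2)] False \<pi>_id[OF \<open>Poly_Mapping.single u a \<in> mpoly_in m\<close>]
        by (auto simp: lookup_minus lookup_single when_def)
    qed
  next
    case (add x y)
    have "of_nat p dvd (Poly_Mapping.lookup (b (\<pi> (x + y))) 0 - (Poly_Mapping.lookup (b (\<pi> x)) 0 + Poly_Mapping.lookup (b (\<pi> y)) 0))
        + ((Poly_Mapping.lookup (b (\<pi> x)) 0 - Poly_Mapping.lookup x 0) + (Poly_Mapping.lookup (b (\<pi> y)) 0 - Poly_Mapping.lookup y 0))"
      using const_I[OF b_add[OF \<pi>_in \<pi>_in, of x y]] add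
      by (intro dvd_add) (simp_all add: \<pi>_add lookup_minus lookup_add)
    thus ?case by (simp add: lookup_add algebra_simps)
  qed
  show thesis
  proof (rule that[of "\<lambda>g. b (\<pi> g)"])
    show "b (\<pi> g) \<in> K" for g by (intro b \<pi>_in)
    show "b (\<pi> (g + h)) - (b (\<pi> g) + b (\<pi> h)) \<in> ?I" for g h unfolding \<pi>_add by (intro b_add \<pi>_in)
    show "b (\<pi> (r * g)) - r * b (\<pi> g) \<in> ?I" if "r \<in> K" for r g
    proof -
      have "\<pi> r = r" by (rule \<pi>_id) (use that KL in auto)
      thus ?thesis unfolding \<pi>_mult using b_mult[OF that \<pi>_in] by simp
    qed
    show "b (\<pi> r) - r \<in> ?I" if "r \<in> K" for r
    proof -
      have "\<pi> r = r" by (rule \<pi>_id) (use that KL in auto)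
      thus ?thesis using b_id[OF that] by simp
    qed
  qed (use ct pure in auto)
qed

text \<open>The heart of the matter, for any base domain with a \<open>p\<close>-derivation in which \<open>p\<close> divides \<open>x\<close> whenever it
  divides \<open>x\<^sup>p\<close>, and with \<open>M\<close> in place of \<open>\<mm>\<close>.\<close>

lemma symbolic_power_subset_power_of_irrelevant_ideal:
  fixes F :: "'a::idom mpolynomial set" and Q M :: "'a mpolynomial set"
  defines "K \<equiv> subalgebra_generated F"
  assumes p: "Factorial_Ring.prime p" and pd: "p_derivation p (\<delta>\<^sub>0 :: 'a \<Rightarrow> 'a)"
    and radical: "\<And>x :: 'a. of_nat p dvd x ^ p \<Longrightarrow> of_nat p dvd x"
    and w: "\<And>i. i < m \<Longrightarrow> w i > 0"
    and F: "F \<subseteq> mpoly_in m" and D: "D > 0"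
    and homog: "\<And>g. g \<in> F \<Longrightarrow> \<exists>i>0. i \<le> D \<and> g \<in> homog w i"
    and summand: "graded_direct_summand_mod (ring_on K) (ring_on (mpoly_in m)) (homog w) (of_nat p)"
    and M: "ideal M (ring_on K)" "F \<subseteq> M" "of_nat p \<in> M" "\<And>g. g \<in> M \<Longrightarrow> of_nat p dvd Poly_Mapping.lookup g 0"
    and Q: "primeideal Q (ring_on K)" "of_nat p \<in> Q" "Q \<subseteq> M"
  shows "symbolic_power K Q (n * D) \<subseteq> ideal_power (ring_on K) M n"
proof
  fix r assume r: "r \<in> symbolic_power K Q (n * D)"
  have K: "cring (ring_on K)" unfolding K_def by (rule cring_subalgebra)
  note Kc = ring_on_closed[OF K]
  have KL: "K \<subseteq> mpoly_in m" unfolding K_def by (rule subalgebra_subset[OF F])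
  have Qi: "ideal Q (ring_on K)" using Q(1) by (rule primeideal.axioms)
  note Qc = ideal_ring_onD[OF Qi]
  let ?I = "PIdl\<^bsub>ring_on K\<^esub> (of_nat p)"
  have IQ: "?I \<subseteq> Q" using Qc(4)[OF Q(2)] by (auto simp: cgenideal_ring_on)
  have rK: "r \<in> K" using r by (simp add: symbolic_power_def)

  obtain b where b: "\<And>g. b g \<in> K"
    and b_add: "\<And>g h. b (g + h) - (b g + b h) \<in> ?I"
    and b_mult: "\<And>r g. r \<in> K \<Longrightarrow> b (r * g) - r * b g \<in> ?I"
    and b_id: "\<And>r. r \<in> K \<Longrightarrow> b r - r \<in> ?I"
    and b_const: "\<And>g. of_nat p dvd Poly_Mapping.lookup (b g) 0 - Poly_Mapping.lookup g 0"
    and pure: "K \<inter> PIdl\<^bsub>ring_on (mpoly_in m)\<^esub> (of_nat p) \<subseteq> ?I"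
    using graded_direct_summand_mod_retraction[OF K KL mconst_in_subalgebra[of _ F, folded K_def] w summand] by metis
  have b_cong: "b g \<in> Q" if "b g - x \<in> ?I" "x \<in> Q" for g x
    using Qc(3)[OF subsetD[OF IQ that(1)] that(2)] by simp
  have b_mult_iff: "b (x * g) \<in> Q \<longleftrightarrow> x * b g \<in> Q" if "x \<in> K" for x g
    using b_cong[OF b_mult[OF that]] ideal_ring_on_diff[OF K Qi, of "b (x * g)" "b (x * g) - x * b g"]
      subsetD[OF IQ b_mult[OF that, of g]] by auto

  \<comment> \<open>\<open>J\<close> is the largest ideal that \<open>b\<close> maps into \<open>Q\<close>.\<close>
  define J where "J = {g. \<forall>h. b (h * g) \<in> Q}"
  define W where "W = K - Q"
  have QJ: "Q \<subseteq> J"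
  proof
    fix q assume q: "q \<in> Q"
    have "b (q * h) \<in> Q" for h using b_mult_iff[of q h] q Qc(1) Qc(5)[OF q b] by auto
    thus "q \<in> J" by (simp add: J_def mult.commute)
  qed
  interpret saturated_mpolynomial_ideal J W p \<delta>\<^sub>0
  proof (intro saturated_mpolynomial_ideal.intro saturated_ideal.intro saturated_mpolynomial_ideal_axioms.intro)
    show "ideal J (ring_on UNIV)"
    proof (rule ideal_ring_onI[OF cring_ring_on_UNIV])
      show "0 \<in> J" using QJ Qc(2) by blast
      fix x y assume x: "x \<in> J"
      show "y * x \<in> J" using x by (simp add: J_def mult.assoc[symmetric])
      assume y: "y \<in> J"
      have "b (h * x + h * y) \<in> Q" for h
        by (rule b_cong[OF b_add]) (use x y in \<open>simp add: J_def Qc(3)\<close>)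
      thus "x + y \<in> J" by (simp add: J_def distrib_left)
    qed simp
    have "Q \<noteq> K" using primeideal.I_notcarr[OF Q(1)] by auto
    moreover have "Q = K" if "1 \<in> Q" using Qc(1) Qc(4)[OF that] by auto
    ultimately show "1 \<in> W" using Kc unfolding W_def by auto
    show "s * u \<in> W" if "s \<in> W" "u \<in> W" for s u
      using that primeideal.I_prime[OF Q(1), of s u] Kc unfolding W_def by auto
    show "g \<in> J" if s: "s \<in> W" "s * g \<in> J" for s g
    proof -
      have "b (h * g) \<in> Q" for h
      proof -
        have "b (s * (h * g)) \<in> Q" using s(2) by (simp add: J_def mult.left_commute)
        hence "s * b (h * g) \<in> Q" using b_mult_iff s(1) W_def by blast
        thus ?thesis using primeideal.I_prime[OF Q(1), of s "b (h * g)"] s(1) b unfolding W_def by auto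
      qed
      thus ?thesis by (simp add: J_def)
    qed
    show "of_nat p \<in> J" using QJ Q(2) by blast
    show "of_nat p dvd Poly_Mapping.lookup g 0" if "g \<in> J" for g
    proof -
      have "b (1 * g) \<in> Q" using that unfolding J_def by blast
      hence "of_nat p dvd Poly_Mapping.lookup (b g) 0" using M(4) Q(3) by auto
      from dvd_diff[OF this b_const[of g]] show ?thesis by simp
    qed
  qed (rule p | rule pd | erule radical)+

  obtain s where s: "s \<in> W" "s * r \<in> ideal_power (ring_on K) Q (n * D)"
    using symbolic_power_denominator[OF K Q(1) r] unfolding W_def by blast
  have "ideal_power (ring_on K) Q (n * D) \<subseteq> Jpow (n * D)"
    by (rule ideal_power_mono_ring[OF _ QJ cring_ring_on_UNIV ideal_J]) simp
  hence rJ: "r \<in> Jsat (n * D)" using s unfolding saturated_power_def by blast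

  note Mn = ideal_power_ideal[OF K M(1)]
  have comp: "component w j r \<in> ideal_power (ring_on K) M n" for j
  proof (rule ccontr)
    assume notin: "component w j r \<notin> ideal_power (ring_on K) M n"
    have comp_in: "component w j x \<in> ideal_power (ring_on K) M k" if "x \<in> K" "k * D < j + D" for x k
      using component_in_ideal_power[OF M(1)[unfolded K_def] M(2) D homog that(1)[unfolded K_def] that(2)]
      unfolding K_def .
    \<comment> \<open>A maximal \<open>a\<close> exists because \<open>p\<^sup>n R\<close> lies in \<open>M\<^sup>n\<close>.\<close>
    define P where "P = (\<lambda>a. \<exists>x\<in>K. component w j r = of_nat p ^ a * x)"
    have lt: "a < n" if "P a" for a
    proof (rule ccontr)
      assume "\<not> a < n"
      obtain x where x: "x \<in> K" "component w j r = of_nat p ^ a * x" using \<open>P a\<close> P_def by blast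
      have "of_nat p ^ a * x \<in> ideal_power (ring_on K) M a"
        by (rule ideal_ring_onD(5)[OF Mn power_in_ideal_power[OF K M(1,3)] x(1)])
      thus False using notin x ideal_power_antimono[OF K M(1)] \<open>\<not> a < n\<close> by (metis not_less subsetD)
    qed
    have "P 0" using comp_in[OF rK, of 0] D unfolding P_def ideal_power_0 by auto
    define a where "a = (GREATEST a. P a)"
    have Pa: "P a" unfolding a_def by (rule GreatestI_nat[of P 0 n, OF \<open>P 0\<close>]) (use lt in \<open>auto intro: less_imp_le\<close>)
    have max: "\<not> P (Suc a)"
    proof
      assume "P (Suc a)"
      hence "Suc a \<le> a" unfolding a_def by (rule Greatest_le_nat[of P _ n]) (use lt in \<open>auto intro: less_imp_le\<close>)
      thus False by simp
    qed
    from Pa obtain x where x: "x \<in> K" "component w j r = of_nat p ^ a * x" unfolding P_def by blast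
    have p0: "(of_nat p :: 'a) \<noteq> 0" using pd unfolding p_derivation_def by (metis mult_zero_left zero_neq_one)
    have lookup_pow: "Poly_Mapping.lookup (of_nat p ^ a * g) u = of_nat p ^ a * Poly_Mapping.lookup g u"
      for g :: "'a mpolynomial" and u
      using lookup_of_nat_mult[of "p ^ a" g u] by simp
    have x_lookup: "of_nat p ^ a * Poly_Mapping.lookup x u =
        (if monom_degree w u = j then Poly_Mapping.lookup r u else 0)" for u
      unfolding lookup_pow[symmetric] x(2)[symmetric] by (simp add: component_def lookup_restrict_keys)
    have x_homog: "component w j x = x"
    proof (rule poly_mapping_eqI)
      fix u
      have "monom_degree w u \<noteq> j \<Longrightarrow> Poly_Mapping.lookup x u = 0" using x_lookup[of u] p0 by simp
      thus "Poly_Mapping.lookup (component w j x) u = Poly_Mapping.lookup x u"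
        by (simp add: component_def lookup_restrict_keys)
    qed

    \<comment> \<open>This is \<open>\<lceil>j/D\<rceil>\<close>.\<close>
    define k where "k = (j + D - 1) div D"
    have "k * D + (j + D - 1) mod D = j + D - 1" by (simp add: k_def)
    moreover have "(j + D - 1) mod D < D" using D by simp
    ultimately have k: "k * D < j + D" "j \<le> k * D" using D by linarith+
    have "a + k < n"
    proof (rule ccontr)
      assume "\<not> a + k < n"
      have "of_nat p ^ a * x \<in> ideal_power (ring_on K) M (a + k)"
        using ideal_power_mult[OF K M(1) power_in_ideal_power[OF K M(1,3)] comp_in[OF x(1) k(1)]]
        by (simp add: x_homog)
      thus False using notin x \<open>\<not> a + k < n\<close> ideal_power_antimono[OF K M(1)] by (metis not_less subsetD)
    qed
    hence "(a + k + 1) * D \<le> n * D" by (intro mult_le_mono1) simp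
    moreover have "a \<le> a * D" using D by simp
    moreover have "(a + k + 1) * D = a * D + k * D + D" by (simp add: add_mult_distrib)
    ultimately have small: "a + j < n * D" using k(2) D by linarith

    \<comment> \<open>Otherwise \<open>x\<close> would be divisible by \<open>p\<close> in the polynomial ring, hence in \<open>K\<close> by injectivity modulo \<open>p\<close>.\<close>
    have "\<not> (\<forall>u. of_nat p dvd Poly_Mapping.lookup x u)"
    proof
      assume "\<forall>u. of_nat p dvd Poly_Mapping.lookup x u"
      then obtain y where y: "y \<in> mpoly_in m" "x = mconst (of_nat p) * y"
        using dvd_lookup_imp_dvd[of "of_nat p" x m] x(1) KL by blast
      have "x = y * of_nat p" using y by (simp add: mconst_def mult.commute)
      hence "x \<in> PIdl\<^bsub>ring_on (mpoly_in m)\<^esub> (of_nat p)" using y(1) unfolding cgenideal_ring_on by blast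
      hence "x \<in> ?I" using pure x(1) by blast
      then obtain z where "z \<in> K" "x = z * of_nat p" by (auto simp: cgenideal_ring_on)
      hence "P (Suc a)" unfolding P_def using x(2) by (auto simp: ac_simps intro!: bexI[of _ z])
      thus False using max by blast
    qed
    then obtain \<alpha> where \<alpha>: "\<not> of_nat p dvd Poly_Mapping.lookup x \<alpha>" by blast
    hence "Poly_Mapping.lookup x \<alpha> \<noteq> 0" by auto
    hence deg: "monom_degree w \<alpha> = j" using x_lookup[of \<alpha>] p0 by (auto split: if_splits)
    have "\<alpha> \<in> Poly_Mapping.keys x" using \<open>Poly_Mapping.lookup x \<alpha> \<noteq> 0\<close> by (simp add: in_keys_iff)
    hence "Poly_Mapping.keys \<alpha> \<subseteq> {..<m}" using x(1) KL by (auto simp: mpoly_in_def)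
    hence "monom_degree (\<lambda>_. 1) \<alpha> \<le> monom_degree w \<alpha>"
      unfolding monom_degree_def using w by (intro sum_mono mult_le_mono1) (auto simp: Suc_le_eq)
    hence "a + monom_degree (\<lambda>_. 1) \<alpha> < n * D" using small deg by linarith
    from coefficient_of_Jsat[OF rJ this] show False using x_lookup[of \<alpha>] deg \<alpha> by auto
  qed
  obtain C where "r = (\<Sum>j\<in>C. component w j r)" using sum_components[of r w] by blast
  also have "\<dots> \<in> ideal_power (ring_on K) M n" by (rule ideal_ring_on_sum[OF Mn comp])
  finally show "r \<in> ideal_power (ring_on K) M n" .
qed

theorem theorem3p3:
  fixes p m t D :: nat
    and w d :: "nat \<Rightarrow> nat"
    and f :: "nat \<Rightarrow> 'a::idom mpolynomial"
    and A :: "'a ring"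
    and S R :: "'a mpolynomial ring"
    and \<mm> :: "'a mpolynomial set"
  assumes p: "Factorial_Ring.prime p"
    and A: "A = ring_on UNIV"
    and base: "A \<simeq> int_ring \<or>
      (dvr A \<and> uniformizer A (of_nat p) \<and> (\<exists>\<delta> :: 'a \<Rightarrow> 'a. p_derivation p \<delta>))"
    and S: "S = ring_on (mpoly_in m)"
    and w: "\<And>i. i < m \<Longrightarrow> w i > 0"
    and t: "t \<ge> 1"
    and f: "\<And>i. i < t \<Longrightarrow> f i \<in> carrier S \<and> f i \<in> homog w (d i) \<and> d i > 0"
    and R: "R = ring_on (subalgebra_generated (f ` {..<t}))"
    and summand: "graded_direct_summand_mod R S (homog w) (of_nat p)"
    and \<mm>: "\<mm> = Idl\<^bsub>R\<^esub> (f ` {..<t}) <+>\<^bsub>R\<^esub> PIdl\<^bsub>R\<^esub> (of_nat p)"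
    and D: "D = Max (d ` {..<t})"
  shows "\<forall>n \<ge> 1. \<forall>Q. primeideal Q R \<longrightarrow> of_nat p \<in> Q \<longrightarrow> Q \<subseteq> \<mm> \<longrightarrow>
    symbolic_power (carrier R) Q (n * D) \<subseteq> ideal_power R \<mm> n"
proof (intro allI impI)
  fix n Q assume Q: "primeideal Q R" "of_nat p \<in> Q" "Q \<subseteq> \<mm>"
  define F where "F = f ` {..<t}"
  define K where "K = subalgebra_generated F"
  have RK: "R = ring_on K" by (simp add: R K_def F_def)
  have K: "cring (ring_on K)" unfolding K_def by (rule cring_subalgebra)
  interpret cring "ring_on K" by (rule K)
  have FK: "F \<subseteq> K" unfolding K_def by (auto intro: gen_in_subalgebra)
  have pK: "of_nat p \<in> K" by (rule ring_on_closed[OF K])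
  have dD: "d i \<le> D" if "i < t" for i unfolding D by (rule Max_ge) (use that in auto)
  have D0: "D > 0" using dD[of 0] f[of 0] t by force
  obtain \<delta>\<^sub>0 :: "'a \<Rightarrow> 'a" where pd: "p_derivation p \<delta>\<^sub>0"
    using base p_derivation_int(1)[OF p] unfolding A by blast
  have radical: "of_nat p dvd x" if "of_nat p dvd x ^ p" for x :: 'a
    using base p_derivation_int(2)[OF p _ that] dvd_power_uniformizer[OF _ that] unfolding A by blast

  have IF: "ideal (Idl\<^bsub>ring_on K\<^esub> F) (ring_on K)" by (rule genideal_ideal) (use FK in simp)
  have Ip: "ideal (PIdl\<^bsub>ring_on K\<^esub> (of_nat p)) (ring_on K)" by (rule cgenideal_ideal) (use pK in simp)
  have \<mm>_eq: "\<mm> = Idl\<^bsub>ring_on K\<^esub> F <+>\<^bsub>ring_on K\<^esub> PIdl\<^bsub>ring_on K\<^esub> (of_nat p)"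
    by (simp add: \<mm> RK F_def)
  have mem: "x \<in> \<mm> \<longleftrightarrow> (\<exists>y\<in>Idl\<^bsub>ring_on K\<^esub> F. \<exists>z\<in>PIdl\<^bsub>ring_on K\<^esub> (of_nat p). x = y + z)" for x
    by (auto simp: \<mm>_eq set_add_def')
  have m_ideal: "ideal \<mm> (ring_on K)" unfolding \<mm>_eq by (rule add_ideals[OF IF Ip])
  have Fm: "F \<subseteq> \<mm>"
  proof
    fix g assume "g \<in> F"
    hence "g \<in> Idl\<^bsub>ring_on K\<^esub> F" using genideal_self[of F] FK by auto
    thus "g \<in> \<mm>" unfolding mem by (intro bexI[of _ g] bexI[of _ 0] ideal_ring_onD(2)[OF Ip]) simp_all
  qed
  have pm: "of_nat p \<in> \<mm>"
  proof -
    have "of_nat p \<in> PIdl\<^bsub>ring_on K\<^esub> (of_nat p)"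
      using ring_on_closed(2)[OF K] by (force simp: cgenideal_ring_on)
    thus ?thesis unfolding mem using ideal_ring_onD(2)[OF IF] by force
  qed
  have const: "of_nat p dvd Poly_Mapping.lookup g 0" if "g \<in> \<mm>" for g
  proof -
    define N where "N = {x \<in> K. of_nat p dvd Poly_Mapping.lookup x 0}"
    have N: "ideal N (ring_on K)"
      by (rule ideal_ring_onI[OF K])
        (auto simp: N_def ring_on_closed[OF K] lookup_add lookup_0_mult)
    have "F \<subseteq> N"
    proof
      fix g assume g: "g \<in> F"
      then obtain i where i: "i < t" "g = f i" unfolding F_def by auto
      have "Poly_Mapping.lookup g 0 = 0"
      proof (rule ccontr)
        assume "Poly_Mapping.lookup g 0 \<noteq> 0"
        hence "0 \<in> Poly_Mapping.keys (f i)" by (simp add: in_keys_iff i(2))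
        hence "monom_degree w 0 = d i" using f[OF i(1)] unfolding homog_def by blast
        thus False using f[OF i(1)] by simp
      qed
      thus "g \<in> N" using g FK by (auto simp: N_def)
    qed
    hence "Idl\<^bsub>ring_on K\<^esub> F \<subseteq> N" by (rule genideal_minimal[OF N])
    moreover have "PIdl\<^bsub>ring_on K\<^esub> (of_nat p) \<subseteq> N"
    proof (rule cgenideal_minimal[OF N])
      show "of_nat p \<in> N" using pK lookup_of_nat_mult[of p "1 :: 'a mpolynomial" 0] by (simp add: N_def)
    qed
    ultimately have "g \<in> N" using that ideal_ring_onD(3)[OF N] unfolding mem by blast
    thus ?thesis by (simp add: N_def)
  qed
  have FS: "F \<subseteq> mpoly_in m" using f unfolding F_def S by auto
  have homog: "\<exists>i>0. i \<le> D \<and> g \<in> homog w i" if "g \<in> F" for g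
    using that f dD unfolding F_def by blast
  have "symbolic_power K Q (n * D) \<subseteq> ideal_power (ring_on K) \<mm> n"
    unfolding K_def
    by (rule symbolic_power_subset_power_of_irrelevant_ideal[where m = m and w = w, OF p pd])
      (fact radical w FS D0 homog summand[unfolded S RK K_def] m_ideal[unfolded K_def] Fm pm const
        Q[unfolded RK K_def])+
  thus "symbolic_power (carrier R) Q (n * D) \<subseteq> ideal_power R \<mm> n" by (simp add: RK)
qed

end
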